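(* Let $\{(\mathbf{x}^k,\mathbf{r}^k,\boldsymbol{\lambda}^k)\}$ be generated by Algorithm 2 under the bounded-delay assumption, with $0<\rho\le\frac{\beta}{m}$ and, for some $\alpha>0$, $$\mathbf{P}_i\succeq\Big(L_i+\alpha L_c+\frac{\tau L_i}{m}+\frac{(\kappa/\alpha+2)L_r\tau^2}{m}\Big)\mathbf{I}+\beta\mathbf{A}_i^\top\mathbf{A}_i,\quad i=1,\ldots,m,$$ where $L_c=\max_iL_i$ and $\kappa=L_r/L_c$. Then $F(\mathbf{x}^k)\to F(\mathbf{x}^* )$ in probability and $\|\mathbf{r}^k\|\to0$ in probability, where $\mathbf{x}^*$ is as in the solution-existence assumption.
   Context: Problem: $\min_{\mathbf{x}} F(\mathbf{x}):=f(\mathbf{x})+g(\mathbf{x})$ s.t. $\mathbf{A}\mathbf{x}=\mathbf{b}$, where $\mathbf{x}=(\mathbf{x}_1;\ldots;\mathbf{x}_m)$ with blocks $\mathbf{x}_i\in\mathbb{R}^{n_i}$, $g(\mathbf{x})=\sum_{i=1}^m g_i(\mathbf{x}_i)$, $\mathbf{A}=[\mathbf{A}_1,\ldots,\mathbf{A}_m]$ with $\mathbf{A}_i\in\mathbb{R}^{q\times n_i}$, $\mathbf{b}\in\mathbb{R}^q$; $f$ is convex and continuously differentiable, each $g_i$ is proper, convex, lower semicontinuous. Define $\Phi(\bar{\mathbf{x}},\mathbf{x},\boldsymbol{\lambda})=F(\bar{\mathbf{x}})-F(\mathbf{x})-\langle\boldsymbol{\lambda},\mathbf{A}\bar{\mathbf{x}}-\mathbf{b}\rangle$.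 $\mathbf{U}_i\mathbf{y}$ denotes the vector whose $i$-th block is $\mathbf{y}_i$ and other blocks zero; $\|\mathbf{z}\|_{\mathbf{M}}^2=\mathbf{z}^\top\mathbf{M}\mathbf{z}$. Assumption (existence of a solution): there is $(\mathbf{x}^*,\boldsymbol{\lambda}^* )$ with $\mathbf{A}\mathbf{x}^*=\mathbf{b}$ and $\Phi(\mathbf{x},\mathbf{x}^*,\boldsymbol{\lambda}^* )\ge0$ for all $\mathbf{x}$. Assumption (gradient Lipschitz continuity): there are constants $L_i>0$ and $L_r$ with $\|\nabla_i f(\mathbf{x}+\mathbf{U}_i\mathbf{y})-\nabla_i f(\mathbf{x})\|\le L_i\|\mathbf{y}_i\|$ and $\|\nabla f(\mathbf{x}+\mathbf{U}_i\mathbf{y})-\nabla f(\mathbf{x})\|\le L_r\|\mathbf{y}_i\|$ for all $i,\mathbf{x},\mathbf{y}$. Algorithm 2 (async-parallel randomized primal-dual block update, as analyzed): choose $\mathbf{x}^0$, $\boldsymbol{\lambda}^0=\mathbf{0}$, $\mathbf{r}^0=\mathbf{A}\mathbf{x}^0-\mathbf{b}$, $\beta>0,\rho>0$, symmetric PSD $\mathbf{P}_i$. At iteration $k$, a block index $i_k\in\{1,\ldots,m\}$ and a (possibly outdated) point $\hat{\mathbf{x}}^k$ are used; $\mathbf{x}_i^{k+1}=\mathbf{x}_i^k$ for $i\ne i_k$ and $$\mathbf{x}_{i_k}^{k+1}\in\arg\min_{\mathbf{x}_{i_k}}\big\langle\nabla_{i_k} f(\hat{\mathbf{x}}^k)-\mathbf{A}_{i_k}^\top(\boldsymbol{\lambda}^k-\beta\mathbf{r}^k),\mathbf{x}_{i_k}\big\rangle+g_{i_k}(\mathbf{x}_{i_k})+\tfrac12\|\mathbf{x}_{i_k}-\mathbf{x}_{i_k}^k\|_{\mathbf{P}_{i_k}}^2;$$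 then $\mathbf{r}^{k+1}=\mathbf{r}^k+\mathbf{A}_{i_k}(\mathbf{x}_{i_k}^{k+1}-\mathbf{x}_{i_k}^k)$ and $\boldsymbol{\lambda}^{k+1}=\boldsymbol{\lambda}^k-\rho\mathbf{r}^{k+1}$. Conditionally on the history before iteration $k$ (which determines $\mathbf{x}^k,\mathbf{r}^k,\boldsymbol{\lambda}^k$ and $\hat{\mathbf{x}}^k$), $i_k$ is uniformly distributed on $\{1,\ldots,m\}$. Assumption (bounded delay): there is an integer $\tau\ge0$ such that $\hat{\mathbf{x}}^k=\mathbf{x}^k+\sum_{d\in J(k)}(\mathbf{x}^d-\mathbf{x}^{d+1})$ for some subset $J(k)\subseteq\{k-\tau,\ldots,k-1\}$ (with $\mathbf{x}^d:=\mathbf{x}^0$ for $d<0$). *)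

theory Defs
  imports "HOL-Analysis.Analysis" "HOL-Probability.Probability"
begin

text \<open>Block structure: the coordinates of the ambient space real^'n are partitioned
into blocks 0,...,m-1 by a map blk; block i consists of the coordinates j with blk j = i.\<close>

definition Ublk :: "('n::finite \<Rightarrow> nat) \<Rightarrow> nat \<Rightarrow> real^'n \<Rightarrow> real^'n" where
  "Ublk blk i y = (\<chi> j. if blk j = i then y $ j else 0)"

definition convex_ext :: "('a::real_vector \<Rightarrow> ereal) \<Rightarrow> bool" where
  "convex_ext h \<longleftrightarrow> (\<forall>x y t. 0 < t \<and> t < 1 \<longrightarrow>
      h (t *\<^sub>R x + (1 - t) *\<^sub>R y) \<le> ereal t * h x + ereal (1 - t) * h y)"

definition proper_ext :: "('a \<Rightarrow> ereal) \<Rightarrow> bool" where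
  "proper_ext h \<longleftrightarrow> (\<forall>x. h x \<noteq> -\<infinity>) \<and> (\<exists>x. h x \<noteq> \<infinity>)"

definition lsc_ext :: "('a::topological_space \<Rightarrow> ereal) \<Rightarrow> bool" where
  "lsc_ext h \<longleftrightarrow> (\<forall>x. h x \<le> Liminf (at x) h)"

definition Fobj :: "('a \<Rightarrow> real) \<Rightarrow> (nat \<Rightarrow> 'a \<Rightarrow> ereal) \<Rightarrow> nat \<Rightarrow> 'a \<Rightarrow> ereal" where
  "Fobj f g m x = ereal (f x) + (\<Sum>i<m. g i x)"

end

theory Submission
  imports Defs
begin

text \<open>Every update is the unique minimiser of a strongly convex function, so each iterate takes only
finitely many values and every random variable below is simple: no integrability question arises.
For a single step one proves a pointwise descent inequality in which the chosen block enters only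
through its index; averaging over the blocks replaces it by the gap of the objective.
This yields a Lyapunov function \<open>Y\<close> with \<open>Y' \<le> Y - \<Phi>/m - \<rho>/(2m) \<parallel>r\<parallel>\<^sup>2 + Z\<close>, where \<open>Z\<close> has
conditional expectation 0. Delayed steps are paid for by a weighted sum of the last \<open>\<tau>\<close> squared
increments, and the dual terms telescope in \<open>\<parallel>\<lambda> - \<lambda>*\<parallel>\<^sup>2\<close>. Hence the expectations of \<open>\<Phi>\<close> and
\<open>\<parallel>r\<parallel>\<^sup>2\<close> are summable. As the objective may be infinite at the starting point, all this is done on the
event that the iterate number \<open>N\<close> lies in the domain, whose complement has probability at most
\<open>m (1 - 1/m)^N\<close>.\<close>

section \<open>Block projections and convex functions\<close>

lemma linear_Ublk: "linear (Ublk blk i)"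
  by (rule linearI) (auto simp: Ublk_def vec_eq_iff)

lemmas Ublk_add = linear_add[OF linear_Ublk]
  and Ublk_diff = linear_diff[OF linear_Ublk]
  and Ublk_scaleR = linear_scale[OF linear_Ublk]

lemma Ublk_inner_commute: "Ublk blk i y \<bullet> z = y \<bullet> Ublk blk i z"
  by (auto simp: Ublk_def inner_vec_def intro!: sum.cong)

lemma Ublk_Ublk: "Ublk blk i (Ublk blk l y) = (if i = l then Ublk blk i y else 0)"
  by (auto simp: Ublk_def vec_eq_iff)

lemma Ublk_eq_self_iff: "Ublk blk i y = y \<longleftrightarrow> (\<forall>j. blk j \<noteq> i \<longrightarrow> y $ j = 0)"
  by (auto simp: Ublk_def vec_eq_iff)

lemma sum_Ublk:
  assumes "\<forall>j. blk j < m"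
  shows "(\<Sum>i<m. Ublk blk i y) = y"
  using assms by (auto simp: vec_eq_iff Ublk_def sum.delta)

lemma sum_norm_Ublk:
  assumes "\<forall>j. blk j < m"
  shows "(\<Sum>i<m. (norm (Ublk blk i y))\<^sup>2) = (norm y)\<^sup>2"
proof -
  have "(norm (Ublk blk i y))\<^sup>2 = Ublk blk i y \<bullet> y" for i
    by (simp add: power2_norm_eq_inner Ublk_inner_commute Ublk_Ublk)
  then show ?thesis
    by (simp add: power2_norm_eq_inner sum_Ublk[OF assms] flip: inner_sum_left)
qed

lemma symmetric_matrix_inner:
  fixes P :: "real^'n^'n"
  assumes "transpose P = P"
  shows "x \<bullet> (P *v y) = y \<bullet> (P *v x)"
  by (metis assms dot_lmul_matrix inner_commute transpose_matrix_vector)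

text \<open>Restricting \<open>f\<close> to the line through \<open>y\<close> and \<open>z\<close>
  reduces this to the tangent inequality for a convex function of one variable.\<close>

lemma convex_on_gradient_le:
  fixes f :: "'a::real_inner \<Rightarrow> real"
  assumes conv: "convex_on UNIV f"
    and grad: "(f has_derivative (\<lambda>h. G \<bullet> h)) (at y)"
  shows "f y + G \<bullet> (z - y) \<le> f z"
proof -
  define \<phi> where "\<phi> t = f (y + t *\<^sub>R (z - y))" for t :: real
  have "convex_on UNIV \<phi>"
  proof (rule convex_onI)
    fix t a c :: real
    assume t: "0 < t" "t < 1"
    have "y + ((1 - t) * a + t * c) *\<^sub>R (z - y)
        = (1 - t) *\<^sub>R (y + a *\<^sub>R (z - y)) + t *\<^sub>R (y + c *\<^sub>R (z - y))"
      by (simp add: algebra_simps)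
    then show "\<phi> ((1 - t) *\<^sub>R a + t *\<^sub>R c) \<le> (1 - t) * \<phi> a + t * \<phi> c"
      using convex_onD[OF conv, of t "y + a *\<^sub>R (z - y)" "y + c *\<^sub>R (z - y)"] t
      by (simp add: \<phi>_def)
  qed simp
  moreover have "(\<phi> has_derivative (\<lambda>h. G \<bullet> (h *\<^sub>R (z - y)))) (at 0)"
    unfolding \<phi>_def
    by (rule has_derivative_compose[where g = f])
      (auto intro!: derivative_eq_intros simp: grad)
  then have "(\<phi> has_field_derivative (G \<bullet> (z - y))) (at 0)"
    by (simp add: has_field_derivative_def mult.commute[of _ "G \<bullet> (z - y)"])
  ultimately have "\<phi> 1 - \<phi> 0 \<ge> (G \<bullet> (z - y)) * (1 - 0)"
    by (intro convex_on_imp_above_tangent[of UNIV]) auto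
  then show ?thesis by (simp add: \<phi>_def)
qed

text \<open>The difference of the two sides along \<open>y + t *\<^sub>R d\<close> has nonpositive
  derivative on [0,1]. The gradient is only tested in direction \<open>d\<close>, so a blockwise
  Lipschitz constant can serve as \<open>C\<close>.\<close>

lemma descent_along_line:
  fixes f :: "'a::real_inner \<Rightarrow> real"
  assumes grad: "\<And>y. (f has_derivative (\<lambda>h. G y \<bullet> h)) (at y)"
    and lip: "\<And>t. 0 \<le> t \<Longrightarrow> (G (y + t *\<^sub>R d) - G y) \<bullet> d \<le> C * t * (norm d)\<^sup>2"
  shows "f (y + d) \<le> f y + G y \<bullet> d + C / 2 * (norm d)\<^sup>2"
proof -
  define \<phi> where "\<phi> t = f (y + t *\<^sub>R d) - t * (G y \<bullet> d) - C / 2 * t\<^sup>2 * (norm d)\<^sup>2" for t :: real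
  have "\<phi> 1 \<le> \<phi> 0"
  proof (rule DERIV_nonpos_imp_nonincreasing[of 0 1 \<phi>])
    fix t :: real
    assume t: "0 \<le> t" "t \<le> 1"
    have "((\<lambda>t. f (y + t *\<^sub>R d)) has_derivative (\<lambda>h. G (y + t *\<^sub>R d) \<bullet> (h *\<^sub>R d))) (at t)"
      by (rule has_derivative_compose[where g = f])
        (auto intro!: derivative_eq_intros simp: grad)
    then have "((\<lambda>t. f (y + t *\<^sub>R d)) has_field_derivative (G (y + t *\<^sub>R d) \<bullet> d)) (at t)"
      by (simp add: has_field_derivative_def mult.commute[of _ "_ \<bullet> _"])
    then have "(\<phi> has_field_derivative
        (G (y + t *\<^sub>R d) \<bullet> d - G y \<bullet> d - C * t * (norm d)\<^sup>2)) (at t)"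
      unfolding \<phi>_def by (auto intro!: derivative_eq_intros)
    moreover have "G (y + t *\<^sub>R d) \<bullet> d - G y \<bullet> d - C * t * (norm d)\<^sup>2 \<le> 0"
      using lip[OF t(1)] by (simp add: inner_diff_left)
    ultimately show "\<exists>D. DERIV \<phi> t :> D \<and> D \<le> 0" by blast
  qed simp
  then show ?thesis by (simp add: \<phi>_def)
qed

text \<open>Comparing the minimiser with the points of the segment towards \<open>z\<close> and letting the
  segment parameter tend to 0 yields the variational inequality without subdifferentials.\<close>

lemma prox_variational_inequality:
  fixes h :: "real^'n \<Rightarrow> ereal" and P :: "real^'n^'n"
  assumes conv: "convex_ext h" and proper: "proper_ext h"
    and sym: "transpose P = P"
    and fin: "h z \<noteq> \<infinity>"
    and min: "\<And>t. 0 < t \<Longrightarrow> t \<le> 1 \<Longrightarrow>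
      ereal (v \<bullet> u + (1/2) * ((u - x) \<bullet> (P *v (u - x)))) + h u
      \<le> ereal (v \<bullet> (t *\<^sub>R z + (1 - t) *\<^sub>R u)
          + (1/2) * ((t *\<^sub>R z + (1 - t) *\<^sub>R u - x) \<bullet> (P *v (t *\<^sub>R z + (1 - t) *\<^sub>R u - x))))
        + h (t *\<^sub>R z + (1 - t) *\<^sub>R u)"
  shows "h u \<noteq> \<infinity>"
    and "real_of_ereal (h u) - real_of_ereal (h z) \<le> v \<bullet> (z - u) + (z - u) \<bullet> (P *v (u - x))"
proof -
  have nm: "h y \<noteq> -\<infinity>" for y using proper by (auto simp: proper_ext_def)
  obtain hz where hz: "h z = ereal hz" using fin nm[of z] by (cases "h z") auto
  \<comment> \<open>At \<open>t = 1\<close> the competitor is \<open>z\<close> itself, whose value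
    is finite.\<close>
  show hu_fin: "h u \<noteq> \<infinity>" using min[of 1] hz by auto
  then obtain hu where hu: "h u = ereal hu" using nm[of u] by (cases "h u") auto
  define q where "q = (z - u) \<bullet> (P *v (z - u))"
  define B where "B = v \<bullet> (z - u) + (z - u) \<bullet> (P *v (u - x))"
  have quotient: "hu - hz \<le> B + t * (q / 2)" if t: "0 < t" "t < 1" for t
  proof -
    define zt where "zt = t *\<^sub>R z + (1 - t) *\<^sub>R u"
    have "h zt \<le> ereal t * h z + ereal (1 - t) * h u"
      using conv t unfolding convex_ext_def zt_def by blast
    then have hzt: "h zt \<le> ereal (t * hz + (1 - t) * hu)" by (simp add: hz hu)
    have "ereal (v \<bullet> u + (1/2) * ((u - x) \<bullet> (P *v (u - x))) + hu)
        \<le> ereal (v \<bullet> zt + (1/2) * ((zt - x) \<bullet> (P *v (zt - x)))) + h zt"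
      using min[of t] t hu by (simp add: zt_def)
    also have "\<dots> \<le> ereal (v \<bullet> zt + (1/2) * ((zt - x) \<bullet> (P *v (zt - x)))) + ereal (t * hz + (1 - t) * hu)"
      by (intro add_left_mono hzt)
    finally have ineq: "v \<bullet> u + (1/2) * ((u - x) \<bullet> (P *v (u - x))) + hu
        \<le> v \<bullet> zt + (1/2) * ((zt - x) \<bullet> (P *v (zt - x))) + (t * hz + (1 - t) * hu)"
      by simp
    have zx: "zt - x = (u - x) + t *\<^sub>R (z - u)" by (simp add: zt_def algebra_simps)
    have "(zt - x) \<bullet> (P *v (zt - x)) = (u - x) \<bullet> (P *v (u - x))
        + 2 * t * ((z - u) \<bullet> (P *v (u - x))) + t\<^sup>2 * q"
      unfolding zx q_def matrix_vector_right_distrib matrix_vector_mult_scaleR inner_add_left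
        inner_add_right inner_scaleR_left inner_scaleR_right
        symmetric_matrix_inner[OF sym, of "u - x" "z - u"]
      by algebra
    moreover have "v \<bullet> zt = v \<bullet> u + t * (v \<bullet> (z - u))"
      by (simp add: zt_def inner_add_right inner_diff_right algebra_simps)
    ultimately have "t * (hu - hz) \<le> t * (B + t * (q / 2))"
      using ineq by (simp add: B_def power2_eq_square algebra_simps)
    then show ?thesis using t by simp
  qed
  have "((\<lambda>t. B + t * (q / 2)) \<longlongrightarrow> B + 0 * (q / 2)) (at_right 0)"
    by (intro tendsto_intros)
  moreover have "eventually (\<lambda>t. hu - hz \<le> B + t * (q / 2)) (at_right 0)"
    by (rule eventually_at_rightI[of 0 1]) (use quotient in auto)
  ultimately have "hu - hz \<le> B + 0 * (q / 2)"
    by (intro tendsto_lowerbound[where F = "at_right 0"]) auto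
  then show "real_of_ereal (h u) - real_of_ereal (h z) \<le> v \<bullet> (z - u) + (z - u) \<bullet> (P *v (u - x))"
    by (simp add: hu hz B_def)
qed

section \<open>One block update\<close>

text \<open>The deterministic data. \<open>Lc\<close> is a positive parameter, instantiated with the
  largest \<open>L i\<close> in the final theorem, and \<kappa> is written out as
  \<open>Lr / Lc\<close>.\<close>

locale block_problem =
  fixes blk :: "'n::finite \<Rightarrow> nat" and m :: nat
    and f :: "real^'n \<Rightarrow> real" and gradf :: "real^'n \<Rightarrow> real^'n"
    and g :: "nat \<Rightarrow> real^'n \<Rightarrow> ereal"
    and A :: "real^'n^'q::finite" and b :: "real^'q"
    and L :: "nat \<Rightarrow> real" and Lr :: real
    and P :: "nat \<Rightarrow> real^'n^'n"
    and \<beta> \<rho> \<alpha> :: real and \<tau> :: nat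
    and xs :: "real^'n" and lams :: "real^'q"
    and Lc :: real
  assumes m_pos: "m \<ge> 1"
    and blk_range: "\<forall>j. blk j < m"
    and f_convex: "convex_on UNIV f"
    and f_grad: "\<And>y. (f has_derivative (\<lambda>h. gradf y \<bullet> h)) (at y)"
    and g_block: "\<And>i y z. i < m \<Longrightarrow> (\<And>j. blk j = i \<Longrightarrow> y $ j = z $ j) \<Longrightarrow> g i y = g i z"
    and g_proper: "\<And>i. i < m \<Longrightarrow> proper_ext (g i)"
    and g_convex: "\<And>i. i < m \<Longrightarrow> convex_ext (g i)"
    and sol_feas: "A *v xs = b"
    and sol_fin: "Fobj f g m xs \<noteq> \<infinity>"
    and sol_opt: "\<And>y. Fobj f g m y - Fobj f g m xs - ereal (lams \<bullet> (A *v y - b)) \<ge> 0"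
    and L_pos: "\<And>i. i < m \<Longrightarrow> L i > 0"
    and Lc_pos: "Lc > 0"
    and Lip_i: "\<And>i y z. i < m \<Longrightarrow>
      norm (Ublk blk i (gradf (y + Ublk blk i z)) - Ublk blk i (gradf y)) \<le> L i * norm (Ublk blk i z)"
    and Lip_r: "\<And>i y z. i < m \<Longrightarrow> norm (gradf (y + Ublk blk i z) - gradf y) \<le> Lr * norm (Ublk blk i z)"
    and \<beta>_pos: "\<beta> > 0" and \<rho>_pos: "\<rho> > 0" and \<rho>_le: "\<rho> \<le> \<beta> / real m"
    and \<alpha>_pos: "\<alpha> > 0"
    and P_sym: "\<And>i. i < m \<Longrightarrow> transpose (P i) = P i"
    and P_block: "\<And>i j l. i < m \<Longrightarrow> blk j \<noteq> i \<or> blk l \<noteq> i \<Longrightarrow> P i $ j $ l = 0"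
    and P_bound: "\<And>i y. i < m \<Longrightarrow> (\<And>j. blk j \<noteq> i \<Longrightarrow> y $ j = 0) \<Longrightarrow>
        y \<bullet> (P i *v y) \<ge>
          (L i + \<alpha> * Lc + \<tau> * L i / m + (Lr / Lc / \<alpha> + 2) * Lr * \<tau>\<^sup>2 / m) * (y \<bullet> y)
          + \<beta> * ((A *v y) \<bullet> (A *v y))"
begin

abbreviation U :: "nat \<Rightarrow> real^'n \<Rightarrow> real^'n" where "U \<equiv> Ublk blk"

text \<open>An infinite value becomes 0. In the one-step estimates \<open>gr i x\<close> cancels
  between \<open>gap x\<close> and \<open>Hb\<close>, so finiteness at the current point matters
  only where \<open>gap\<close> is compared with \<open>Fobj\<close>, in \<open>gap_eq\<close> and
  \<open>gap_ge\<close>.\<close>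

definition gr :: "nat \<Rightarrow> real^'n \<Rightarrow> real" where
  "gr i y = real_of_ereal (g i y)"

definition gap :: "real^'n \<Rightarrow> real" where
  "gap y = f y + (\<Sum>i<m. gr i y) - f xs - (\<Sum>i<m. gr i xs)"

text \<open>Summing over all blocks lets a single-block increment find its own constant
  \<open>L i\<close> without naming the block; see \<open>Lq_block\<close>.\<close>

definition Lq :: "real^'n \<Rightarrow> real" where
  "Lq d = (\<Sum>i<m. L i * (norm (U i d))\<^sup>2)"

definition Pq :: "real^'n \<Rightarrow> real" where
  "Pq y = (\<Sum>i<m. y \<bullet> (P i *v y))"

text \<open>The price of an increment that a delayed read may miss: the term \<open>Lq\<close> and
  the 1 in the bracket come from \<open>path_descent\<close>, the term
  \<open>Lr / Lc / \<alpha>\<close> from the squared gradient error in \<open>Hb\<close>, and the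
  division by \<open>m\<close> from averaging over the blocks.\<close>

definition delay_weight :: "real^'n \<Rightarrow> real" where
  "delay_weight d = (Lq d + Lr * \<tau> * (1 + Lr / Lc / \<alpha>) * (norm d)\<^sup>2) / (2 * m)"

definition single_block :: "real^'n \<Rightarrow> bool" where
  "single_block d \<longleftrightarrow> (\<exists>i<m. U i d = d)"

text \<open>The part of the one-step estimate that depends on the chosen block only through its
  index; its average over the blocks is what convexity of \<open>f\<close> controls.\<close>

definition Hb :: "real^'n \<Rightarrow> real^'n \<Rightarrow> real^'q \<Rightarrow> nat \<Rightarrow> real" where
  "Hb x xh \<mu> i = gr i xs - gr i x + U i (gradf xh) \<bullet> (xs - x) - \<mu> \<bullet> (A *v U i (xs - x))
     + (norm (U i (gradf x - gradf xh)))\<^sup>2 / (2 * \<alpha> * Lc)"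

section \<open>Constants and quadratic forms\<close>

lemma m_real_pos: "real m > 0"
  using m_pos by simp

text \<open>Types are inhabited, so some coordinate exists, and \<open>Lip_r\<close> can be tested
  on its unit vector.\<close>

lemma Lr_nonneg: "Lr \<ge> 0"
proof -
  obtain j :: 'n where True by simp
  have "U (blk j) (axis j 1) = axis j 1"
    unfolding Ublk_eq_self_iff by (auto simp: axis_def)
  then have "0 \<le> Lr * norm (axis j 1 :: real^'n)"
    using Lip_r[of "blk j" 0 "axis j 1"] blk_range by (metis norm_ge_zero order_trans)
  then show ?thesis by (simp add: norm_axis_1)
qed

lemma Lq_nonneg: "Lq d \<ge> 0"
  unfolding Lq_def using L_pos by (intro sum_nonneg) (simp add: less_imp_le)

lemma delay_weight_nonneg: "delay_weight d \<ge> 0"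
  unfolding delay_weight_def
  using Lq_nonneg[of d] Lr_nonneg Lc_pos \<alpha>_pos by simp

lemma Lq_block: "i < m \<Longrightarrow> U i d = d \<Longrightarrow> Lq d = L i * (norm d)\<^sup>2"
proof -
  assume i: "i < m" and d: "U i d = d"
  have "U l d = (if l = i then d else 0)" for l
    using Ublk_Ublk[of blk l i d] d by auto
  then have "Lq d = (\<Sum>l<m. if l = i then L i * (norm d)\<^sup>2 else 0)"
    unfolding Lq_def by (intro sum.cong) auto
  then show ?thesis using i by (simp add: sum.delta)
qed

lemma P_Ublk: "i < m \<Longrightarrow> P i *v U i y = P i *v y"
  using P_block by (auto simp: vec_eq_iff matrix_vector_mult_def Ublk_def intro!: sum.cong)

lemma inner_P_Ublk: "i < m \<Longrightarrow> U i z \<bullet> (P i *v y) = z \<bullet> (P i *v y)"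
  by (metis P_Ublk P_sym symmetric_matrix_inner)

lemma P_form_Ublk: "i < m \<Longrightarrow> y \<bullet> (P i *v y) = U i y \<bullet> (P i *v U i y)"
  by (simp add: P_Ublk inner_P_Ublk)

lemma P_form_ge: "i < m \<Longrightarrow> y \<bullet> (P i *v y) \<ge> (L i + \<alpha> * Lc) * (norm (U i y))\<^sup>2"
proof -
  assume i: "i < m"
  have "U i y \<bullet> (P i *v U i y) \<ge>
      (L i + \<alpha> * Lc + \<tau> * L i / m + (Lr / Lc / \<alpha> + 2) * Lr * \<tau>\<^sup>2 / m) * (U i y \<bullet> U i y)
      + \<beta> * ((A *v U i y) \<bullet> (A *v U i y))"
    using i by (intro P_bound) (auto simp: Ublk_def)
  moreover have "(L i + \<alpha> * Lc + \<tau> * L i / m + (Lr / Lc / \<alpha> + 2) * Lr * \<tau>\<^sup>2 / m) * (U i y \<bullet> U i y)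
      \<ge> (L i + \<alpha> * Lc) * (U i y \<bullet> U i y)"
    using L_pos[OF i] Lr_nonneg Lc_pos \<alpha>_pos by (intro mult_right_mono) (auto intro!: add_nonneg_nonneg mult_nonneg_nonneg)
  moreover have "\<beta> * ((A *v U i y) \<bullet> (A *v U i y)) \<ge> 0" using \<beta>_pos by simp
  ultimately show ?thesis
    unfolding P_form_Ublk[OF i, of y] power2_norm_eq_inner by linarith
qed

text \<open>Definiteness of \<open>P i\<close> on its own block, the source of uniqueness of the
  update.\<close>

lemma P_form_pos: "i < m \<Longrightarrow> y \<bullet> (P i *v y) \<le> 0 \<Longrightarrow> U i y = 0"
proof -
  assume i: "i < m" and le: "y \<bullet> (P i *v y) \<le> 0"
  have "(L i + \<alpha> * Lc) * (norm (U i y))\<^sup>2 \<le> 0" using P_form_ge[OF i, of y] le by linarith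
  moreover have "L i + \<alpha> * Lc > 0" using L_pos[OF i] \<alpha>_pos Lc_pos by (simp add: add_pos_pos)
  ultimately show ?thesis
    using zero_less_mult_iff[of "L i + \<alpha> * Lc" "(norm (U i y))\<^sup>2"] by force
qed

lemma Pq_nonneg: "Pq y \<ge> 0"
  unfolding Pq_def
proof (rule sum_nonneg)
  fix i assume "i \<in> {..<m}"
  then have i: "i < m" by simp
  show "y \<bullet> (P i *v y) \<ge> 0"
    by (rule order_trans[OF _ P_form_ge[OF i]]) (use L_pos[OF i] \<alpha>_pos Lc_pos in simp)
qed

lemma Pq_diff:
  assumes i: "i < m" and eq: "U i (z - y) = z - y"
  shows "Pq y - Pq z = y \<bullet> (P i *v y) - z \<bullet> (P i *v z)"
proof -
  have "U l z = U l y" if "l \<noteq> i" for l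
    using Ublk_Ublk[of blk l i "z - y"] that unfolding eq by (simp add: Ublk_diff)
  then have "y \<bullet> (P l *v y) - z \<bullet> (P l *v z)
      = (if l = i then y \<bullet> (P i *v y) - z \<bullet> (P i *v z) else 0)" if "l < m" for l
    using P_form_Ublk[OF that, of y] P_form_Ublk[OF that, of z] by auto
  then have "Pq y - Pq z = (\<Sum>l<m. if l = i then y \<bullet> (P i *v y) - z \<bullet> (P i *v z) else 0)"
    unfolding Pq_def sum_subtractf[symmetric] by (intro sum.cong) auto
  then show ?thesis using i by (simp add: sum.delta)
qed

section \<open>From extended to real objective values\<close>

lemma g_not_MInf: "i < m \<Longrightarrow> g i y \<noteq> -\<infinity>"
  using g_proper by (auto simp: proper_ext_def)

lemma Fobj_eq_ereal:
  assumes "\<And>i. i < m \<Longrightarrow> g i y \<noteq> \<infinity>"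
  shows "Fobj f g m y = ereal (f y + (\<Sum>i<m. gr i y))"
proof -
  have "(\<Sum>i<m. g i y) = (\<Sum>i<m. ereal (gr i y))"
    unfolding gr_def using assms g_not_MInf by (intro sum.cong) (auto simp: ereal_real)
  then show ?thesis by (simp add: Fobj_def)
qed

lemma g_xs_finite: "i < m \<Longrightarrow> g i xs \<noteq> \<infinity>"
proof
  assume "i < m" "g i xs = \<infinity>"
  then have "(\<Sum>i<m. g i xs) = \<infinity>"
    by (subst sum_Pinfty) auto
  then show False using sol_fin by (simp add: Fobj_def)
qed

lemma gap_eq:
  assumes "\<And>i. i < m \<Longrightarrow> g i y \<noteq> \<infinity>"
  shows "Fobj f g m y - Fobj f g m xs = ereal (gap y)"
  by (simp add: Fobj_eq_ereal assms g_xs_finite gap_def)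

lemma gap_ge:
  assumes "\<And>i. i < m \<Longrightarrow> g i y \<noteq> \<infinity>"
  shows "gap y \<ge> lams \<bullet> (A *v y - b)"
  using sol_opt[of y] by (simp add: gap_eq assms)

section \<open>Lipschitz and descent estimates along a chain of block moves\<close>

lemma gradf_path_lipschitz:
  assumes "finite J" "\<And>d. d \<in> J \<Longrightarrow> single_block (\<delta> d)"
  shows "norm (gradf (y + (\<Sum>d\<in>J. \<delta> d)) - gradf y) \<le> Lr * (\<Sum>d\<in>J. norm (\<delta> d))"
  using assms
proof (induction J rule: finite_induct)
  case (insert e J)
  obtain i where i: "i < m" "U i (\<delta> e) = \<delta> e" using insert.prems by (auto simp: single_block_def)
  have "norm (gradf (y + (\<Sum>d\<in>J. \<delta> d) + \<delta> e) - gradf (y + (\<Sum>d\<in>J. \<delta> d))) \<le> Lr * norm (\<delta> e)"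
    using Lip_r[OF i(1), of "y + (\<Sum>d\<in>J. \<delta> d)" "\<delta> e"] i by simp
  moreover have "norm (gradf (y + (\<Sum>d\<in>J. \<delta> d)) - gradf y) \<le> Lr * (\<Sum>d\<in>J. norm (\<delta> d))"
    using insert by auto
  ultimately show ?case
    using insert.hyps norm_triangle_ineq[of "gradf (y + (\<Sum>d\<in>J. \<delta> d) + \<delta> e) - gradf (y + (\<Sum>d\<in>J. \<delta> d))"
        "gradf (y + (\<Sum>d\<in>J. \<delta> d)) - gradf y"]
    by (simp add: algebra_simps)
qed simp

text \<open>A displacement inside block \<open>i\<close> only sees that block of the gradient, so
  the constant is \<open>L i\<close> rather than \<open>Lr\<close>.\<close>

lemma block_descent:
  assumes i: "i < m" and d: "U i d = d"
  shows "f (y + d) \<le> f y + gradf y \<bullet> d + L i / 2 * (norm d)\<^sup>2"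
proof (rule descent_along_line[OF f_grad])
  fix t :: real
  assume t: "0 \<le> t"
  have td: "U i (t *\<^sub>R d) = t *\<^sub>R d" by (simp add: Ublk_scaleR d)
  have "(gradf (y + t *\<^sub>R d) - gradf y) \<bullet> d
      = (U i (gradf (y + t *\<^sub>R d)) - U i (gradf y)) \<bullet> d"
    using d by (metis Ublk_diff Ublk_inner_commute)
  also have "\<dots> \<le> norm (U i (gradf (y + t *\<^sub>R d)) - U i (gradf y)) * norm d"
    by (rule norm_cauchy_schwarz)
  also have "\<dots> \<le> (L i * norm (t *\<^sub>R d)) * norm d"
    using Lip_i[OF i, of y "t *\<^sub>R d"] by (intro mult_right_mono) (auto simp: td)
  also have "\<dots> = L i * t * (norm d)\<^sup>2" using t by (simp add: power2_eq_square)
  finally show "(gradf (y + t *\<^sub>R d) - gradf y) \<bullet> d \<le> L i * t * (norm d)\<^sup>2" .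
qed

text \<open>The moves are made one at a time. Each pays its own \<open>Lq\<close> term, plus a cross
  term because the gradient is wanted at \<open>y\<close> and not at the point already reached; the
  cross terms build up the square of the total length.\<close>

lemma path_descent:
  assumes "finite J" "\<And>d. d \<in> J \<Longrightarrow> single_block (\<delta> d)"
  shows "f (y + (\<Sum>d\<in>J. \<delta> d)) \<le> f y + gradf y \<bullet> (\<Sum>d\<in>J. \<delta> d)
      + (\<Sum>d\<in>J. Lq (\<delta> d) / 2) + Lr / 2 * (\<Sum>d\<in>J. norm (\<delta> d))\<^sup>2"
  using assms
proof (induction J rule: finite_induct)
  case (insert e J)
  define S where "S = (\<Sum>d\<in>J. \<delta> d)"
  define N where "N = (\<Sum>d\<in>J. norm (\<delta> d))"
  obtain i where i: "i < m" "U i (\<delta> e) = \<delta> e" using insert.prems by (auto simp: single_block_def)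
  have "f (y + S + \<delta> e) \<le> f (y + S) + gradf (y + S) \<bullet> \<delta> e + Lq (\<delta> e) / 2"
    using block_descent[OF i, of "y + S"] Lq_block[OF i] by simp
  moreover have "(gradf (y + S) - gradf y) \<bullet> \<delta> e \<le> Lr * N * norm (\<delta> e)"
    using norm_cauchy_schwarz[of "gradf (y + S) - gradf y" "\<delta> e"]
      mult_right_mono[OF gradf_path_lipschitz[of J \<delta> y], of "norm (\<delta> e)"] insert
    by (force simp: S_def N_def)
  moreover have "f (y + S) \<le> f y + gradf y \<bullet> S + (\<Sum>d\<in>J. Lq (\<delta> d) / 2) + Lr / 2 * N\<^sup>2"
    using insert by (simp add: S_def N_def)
  moreover have "Lr / 2 * N\<^sup>2 + Lr * N * norm (\<delta> e) \<le> Lr / 2 * (norm (\<delta> e) + N)\<^sup>2"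
    using Lr_nonneg by (simp add: power2_sum algebra_simps)
  moreover have "(\<Sum>d\<in>insert e J. \<delta> d) = \<delta> e + S" "(\<Sum>d\<in>insert e J. norm (\<delta> d)) = norm (\<delta> e) + N"
    "(\<Sum>d\<in>insert e J. Lq (\<delta> d) / 2) = Lq (\<delta> e) / 2 + (\<Sum>d\<in>J. Lq (\<delta> d) / 2)"
    using insert.hyps by (simp_all add: S_def N_def)
  ultimately show ?case
    by (simp add: inner_diff_left inner_add_right add.commute add.left_commute)
qed simp

text \<open>Summation over the blocks restores the full gradient at \<open>xh\<close>. Convexity
  bounds its part towards \<open>xs\<close>, and \<open>path_descent\<close> from \<open>xh\<close>
  to \<open>x\<close> handles the rest, so the delay only costs squared increments.\<close>

lemma sum_Hb_le:
  assumes J: "J \<subseteq> D" "finite D" "card D \<le> \<tau>"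
    and single: "\<And>d. d \<in> D \<Longrightarrow> single_block (\<delta> d)"
    and x: "x = xh + (\<Sum>d\<in>J. \<delta> d)"
  shows "(\<Sum>i<m. Hb x xh \<mu> i) \<le> - gap x + \<mu> \<bullet> (A *v x - b) + m * (\<Sum>d\<in>D. delay_weight (\<delta> d))"
proof -
  have finJ: "finite J" using J finite_subset by blast
  define N where "N = (\<Sum>d\<in>J. norm (\<delta> d))"
  \<comment> \<open>Cauchy-Schwarz; the number of missed increments produces the factor \<tau> in
    \<open>delay_weight\<close>.\<close>
  have "N\<^sup>2 \<le> (\<Sum>d\<in>J. (norm (\<delta> d))\<^sup>2) * card J"
    unfolding N_def by (rule sum_squared_le_sum_of_squares)
  also have "\<dots> \<le> (\<Sum>d\<in>J. (norm (\<delta> d))\<^sup>2) * \<tau>"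
    using card_mono[OF J(2,1)] J(3) by (intro mult_left_mono sum_nonneg) auto
  finally have N: "N\<^sup>2 \<le> \<tau> * (\<Sum>d\<in>J. (norm (\<delta> d))\<^sup>2)" by (simp add: mult.commute)
  have "norm (gradf x - gradf xh) \<le> Lr * N"
    unfolding x N_def using single J by (intro gradf_path_lipschitz finJ) auto
  then have "(norm (gradf x - gradf xh))\<^sup>2 \<le> (Lr * N)\<^sup>2" by (intro power_mono) auto
  then have grad: "(norm (gradf x - gradf xh))\<^sup>2 / (2 * \<alpha> * Lc) \<le> (Lr * N)\<^sup>2 / (2 * \<alpha> * Lc)"
    using \<alpha>_pos Lc_pos by (intro divide_right_mono) auto
  have desc: "f x \<le> f xh + gradf xh \<bullet> (x - xh) + (\<Sum>d\<in>J. Lq (\<delta> d) / 2) + Lr / 2 * N\<^sup>2"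
    using path_descent[OF finJ, of \<delta> xh] single J by (auto simp: x N_def)
  have tangent: "f xh + gradf xh \<bullet> (xs - xh) \<le> f xs"
    by (rule convex_on_gradient_le[OF f_convex f_grad])
  have "(\<Sum>i<m. Hb x xh \<mu> i) = (\<Sum>i<m. gr i xs) - (\<Sum>i<m. gr i x) + gradf xh \<bullet> (xs - x)
      - \<mu> \<bullet> (A *v (xs - x)) + (norm (gradf x - gradf xh))\<^sup>2 / (2 * \<alpha> * Lc)"
  proof -
    have "(\<Sum>i<m. U i (gradf xh) \<bullet> (xs - x)) = gradf xh \<bullet> (xs - x)"
      by (simp add: sum_Ublk[OF blk_range] flip: inner_sum_left)
    moreover have "(\<Sum>i<m. \<mu> \<bullet> (A *v U i (xs - x))) = \<mu> \<bullet> (A *v (xs - x))"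
      by (simp add: sum_Ublk[OF blk_range] linear_sum[OF matrix_vector_mul_linear, symmetric]
          flip: inner_sum_right)
    moreover have "(\<Sum>i<m. (norm (U i (gradf x - gradf xh)))\<^sup>2 / (2 * \<alpha> * Lc))
        = (norm (gradf x - gradf xh))\<^sup>2 / (2 * \<alpha> * Lc)"
      by (simp add: sum_norm_Ublk[OF blk_range] flip: sum_divide_distrib)
    ultimately show ?thesis
      unfolding Hb_def by (simp add: sum.distrib sum_subtractf)
  qed
  also have "\<dots> \<le> - gap x + \<mu> \<bullet> (A *v x - b) + ((\<Sum>d\<in>J. Lq (\<delta> d) / 2) + Lr / 2 * N\<^sup>2 + (Lr * N)\<^sup>2 / (2 * \<alpha> * Lc))"
    using desc tangent grad sol_feas
    by (simp add: gap_def matrix_vector_mult_diff_distrib inner_diff_right)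
  also have "(\<Sum>d\<in>J. Lq (\<delta> d) / 2) + Lr / 2 * N\<^sup>2 + (Lr * N)\<^sup>2 / (2 * \<alpha> * Lc)
      = (\<Sum>d\<in>J. Lq (\<delta> d)) / 2 + Lr * (1 + Lr / Lc / \<alpha>) / 2 * N\<^sup>2"
    using \<alpha>_pos Lc_pos by (simp add: sum_divide_distrib power_mult_distrib field_simps power2_eq_square)
  also have "\<dots> \<le> (\<Sum>d\<in>J. Lq (\<delta> d)) / 2 + Lr * (1 + Lr / Lc / \<alpha>) / 2 * (\<tau> * (\<Sum>d\<in>J. (norm (\<delta> d))\<^sup>2))"
    using Lr_nonneg \<alpha>_pos Lc_pos by (intro add_left_mono mult_left_mono N) auto
  also have "\<dots> = m * (\<Sum>d\<in>J. delay_weight (\<delta> d))"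
    unfolding delay_weight_def using m_pos
    by (simp add: sum.distrib sum_distrib_left field_simps flip: sum_divide_distrib)
  \<comment> \<open>Passing to the whole window \<open>D\<close> makes the bound independent of
    which increments were missed.\<close>
  also have "\<dots> \<le> m * (\<Sum>d\<in>D. delay_weight (\<delta> d))"
    using J by (intro mult_left_mono sum_mono2) (auto simp: delay_weight_nonneg)
  finally show ?thesis by simp
qed

end

text \<open>One update with block \<open>i\<close> fixed; \<open>\<mu>\<close> stands for the
  shifted multiplier \<open>lam k w - \<beta> *\<^sub>R r k w\<close>.\<close>

locale block_step = block_problem blk m f gradf g A b L Lr P \<beta> \<rho> \<alpha> \<tau> xs lams Lc
  for blk :: "'n::finite \<Rightarrow> nat" and m f gradf g
    and A :: "real^'n^'q::finite" and b L Lr P \<beta> \<rho> \<alpha> \<tau> xs lams Lc +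
  fixes i :: nat and x x' xh :: "real^'n" and \<mu> :: "real^'q"
  assumes i: "i < m"
    and other: "\<And>j. blk j \<noteq> i \<Longrightarrow> x' $ j = x $ j"
    and argmin: "\<And>z. (\<And>j. blk j \<noteq> i \<Longrightarrow> z $ j = x $ j) \<Longrightarrow>
        ereal (Ublk blk i (gradf xh - transpose A *v \<mu>) \<bullet> x'
               + (1/2) * ((x' - x) \<bullet> (P i *v (x' - x)))) + g i x'
        \<le> ereal (Ublk blk i (gradf xh - transpose A *v \<mu>) \<bullet> z
               + (1/2) * ((z - x) \<bullet> (P i *v (z - x)))) + g i z"
begin

lemma variational_inequality:
  assumes z: "\<And>j. blk j \<noteq> i \<Longrightarrow> z $ j = x $ j" and fin: "g i z \<noteq> \<infinity>"
  shows "g i x' \<noteq> \<infinity>"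
    and "gr i x' - gr i z \<le> U i (gradf xh - transpose A *v \<mu>) \<bullet> (z - x') + (z - x') \<bullet> (P i *v (x' - x))"
  unfolding gr_def
  by (rule prox_variational_inequality[OF g_convex[OF i] g_proper[OF i] P_sym[OF i] fin],
      rule argmin, simp add: z other algebra_simps)+

lemma update_eq: "U i (x' - x) = x' - x"
  unfolding Ublk_eq_self_iff by (simp add: other)

lemma g_solution_block: "g i (x + U i (xs - x)) = g i xs"
  by (rule g_block[OF i]) (simp add: Ublk_def)

text \<open>Replacing block \<open>i\<close> of \<open>x\<close> by that of \<open>xs\<close> gives
  an admissible competitor of finite value, even when \<open>g i x\<close> is infinite. Hence every
  selected block enters its domain.\<close>

lemma g_update_finite: "g i x' \<noteq> \<infinity>"
  by (rule variational_inequality(1)[of "x + U i (xs - x)"])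
    (auto simp: g_solution_block g_xs_finite[OF i], simp add: Ublk_def)

text \<open>The variational inequality is applied to \<open>x\<close> with block \<open>i\<close>
  taken from \<open>xs\<close>; the three-point identity for the form of \<open>P i\<close> then
  splits the proximal term.\<close>

lemma update_bound:
  "gr i x' - gr i xs \<le> U i (gradf xh - transpose A *v \<mu>) \<bullet> (xs - x')
     + ((x - xs) \<bullet> (P i *v (x - xs)) - (x' - xs) \<bullet> (P i *v (x' - xs)) - (x' - x) \<bullet> (P i *v (x' - x))) / 2"
proof -
  define z where "z = x + U i (xs - x)"
  have Uz: "U i (z - x') = U i (xs - x')"
    unfolding z_def by (simp add: Ublk_add Ublk_diff Ublk_Ublk)
  have "gr i x' - gr i z \<le> U i (gradf xh - transpose A *v \<mu>) \<bullet> (z - x') + (z - x') \<bullet> (P i *v (x' - x))"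
    by (rule variational_inequality(2))
      (auto simp: z_def g_solution_block g_xs_finite[OF i], simp add: Ublk_def)
  moreover have "gr i z = gr i xs" by (simp add: z_def gr_def g_solution_block)
  moreover have "U i w \<bullet> (z - x') = U i w \<bullet> (xs - x')" for w
    by (simp add: Ublk_inner_commute Uz)
  moreover have "(z - x') \<bullet> (P i *v y) = (xs - x') \<bullet> (P i *v y)" for y
    by (metis inner_P_Ublk[OF i] Uz)
  moreover have "(xs - x') \<bullet> (P i *v (x' - x))
      = ((x - xs) \<bullet> (P i *v (x - xs)) - (x' - xs) \<bullet> (P i *v (x' - xs)) - (x' - x) \<bullet> (P i *v (x' - x))) / 2"
    using symmetric_matrix_inner[OF P_sym[OF i], of x xs]
      symmetric_matrix_inner[OF P_sym[OF i], of x x']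
      symmetric_matrix_inner[OF P_sym[OF i], of x' xs]
    by (simp add: matrix_vector_mult_diff_distrib inner_diff_left inner_diff_right field_simps)
  ultimately show ?thesis by simp
qed

text \<open>Descent of \<open>f\<close> in block \<open>i\<close> is added to
  \<open>update_bound\<close>. The quadratic terms in the increment are absorbed by the lower bound
  on \<open>P i\<close>, which also leaves the delay and \<beta> terms as a reserve.\<close>

lemma gap_step:
  "gap x' \<le> gap x + Hb x xh \<mu> i + \<mu> \<bullet> (A *v (x' - x)) + (Pq (x - xs) - Pq (x' - xs)) / 2
     - \<tau> * delay_weight (x' - x) - \<beta> / 2 * (norm (A *v (x' - x)))\<^sup>2"
proof -
  define \<delta> where "\<delta> = x' - x"
  define a where "a = U i (gradf x - gradf xh)"
  have \<delta>: "U i \<delta> = \<delta>" using update_eq by (simp add: \<delta>_def)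
  have "(\<Sum>l<m. gr l x') - (\<Sum>l<m. gr l x) = (\<Sum>l<m. if l = i then gr i x' - gr i x else 0)"
    unfolding sum_subtractf[symmetric]
  proof (rule sum.cong)
    fix l assume "l \<in> {..<m}"
    then show "gr l x' - gr l x = (if l = i then gr i x' - gr i x else 0)"
      using g_block[of l x' x] other by (auto simp: gr_def)
  qed simp
  then have G: "(\<Sum>l<m. gr l x') - (\<Sum>l<m. gr l x) = gr i x' - gr i x"
    using i by (simp add: sum.delta)
  have desc: "f x' \<le> f x + gradf x \<bullet> \<delta> + L i / 2 * (norm \<delta>)\<^sup>2"
    using block_descent[OF i \<delta>, of x] by (simp add: \<delta>_def)
  have split: "gradf x \<bullet> \<delta> = a \<bullet> \<delta> + U i (gradf xh) \<bullet> \<delta>"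
    using \<delta> unfolding a_def by (simp add: Ublk_inner_commute inner_diff_left)
  \<comment> \<open>The error of the outdated gradient is split with weight
    \<open>\<alpha> * Lc\<close>: its square is the last term of \<open>Hb\<close>, and the square
    of the increment is charged to \<open>P i\<close>.\<close>
  have young: "a \<bullet> \<delta> \<le> (norm a)\<^sup>2 / (2 * \<alpha> * Lc) + \<alpha> * Lc / 2 * (norm \<delta>)\<^sup>2"
  proof -
    define c where "c = \<alpha> * Lc"
    have c: "c > 0" using \<alpha>_pos Lc_pos by (simp add: c_def)
    have "a \<bullet> \<delta> \<le> norm a * norm \<delta>" by (rule norm_cauchy_schwarz)
    moreover have "0 \<le> (norm a - c * norm \<delta>)\<^sup>2 / (2 * c)" using c by simp
    moreover have "(norm a - c * norm \<delta>)\<^sup>2 / (2 * c)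
        = (norm a)\<^sup>2 / (2 * c) + c / 2 * (norm \<delta>)\<^sup>2 - norm a * norm \<delta>"
      using c by (simp add: power2_eq_square field_simps)
    ultimately show ?thesis by (simp add: c_def mult.assoc)
  qed
  have lin: "U i (gradf xh - transpose A *v \<mu>) \<bullet> (xs - x')
      = U i (gradf xh) \<bullet> (xs - x) - U i (gradf xh) \<bullet> \<delta> - \<mu> \<bullet> (A *v U i (xs - x)) + \<mu> \<bullet> (A *v \<delta>)"
  proof -
    have adj: "U i (transpose A *v \<mu>) \<bullet> y = \<mu> \<bullet> (A *v U i y)" for y
      by (simp add: Ublk_inner_commute dot_lmul_matrix)
    have "xs - x' = (xs - x) - \<delta>" by (simp add: \<delta>_def)
    then show ?thesis
      by (simp only: Ublk_diff[of blk i "gradf xh"] inner_diff_left inner_diff_right[of _ "xs - x"] adj \<delta>)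
  qed
  \<comment> \<open>\<open>e1\<close> pays for descent and Young's inequality, while
    \<open>e2\<close> and \<open>e3\<close> make up the delay price, with \<open>e3\<close>
    dominated by the term \<open>e4\<close> of \<open>P_bound\<close>.\<close>
  have P: "(L i + \<alpha> * Lc) / 2 * (norm \<delta>)\<^sup>2 - (\<delta> \<bullet> (P i *v \<delta>)) / 2
      \<le> - \<tau> * delay_weight \<delta> - \<beta> / 2 * (norm (A *v \<delta>))\<^sup>2"
  proof -
    define e1 where "e1 = L i + \<alpha> * Lc"
    define e2 where "e2 = \<tau> * L i / m"
    define e3 where "e3 = (Lr / Lc / \<alpha> + 1) * Lr * \<tau>\<^sup>2 / m"
    define e4 where "e4 = (Lr / Lc / \<alpha> + 2) * Lr * \<tau>\<^sup>2 / m"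
    define s where "s = (norm \<delta>)\<^sup>2"
    have "(e1 + e2 + e4) * s + \<beta> * (norm (A *v \<delta>))\<^sup>2 \<le> \<delta> \<bullet> (P i *v \<delta>)"
      unfolding e1_def e2_def e4_def s_def power2_norm_eq_inner
      by (rule P_bound[OF i]) (use \<delta> in \<open>simp add: Ublk_eq_self_iff\<close>)
    moreover have "\<tau> * delay_weight \<delta> = (e2 + e3) * s / 2"
      unfolding delay_weight_def Lq_block[OF i \<delta>] s_def[symmetric] e2_def e3_def
      using m_pos by (simp add: field_simps power2_eq_square)
    moreover have "e3 * s \<le> e4 * s"
      using Lr_nonneg unfolding s_def e3_def e4_def
      by (intro mult_right_mono divide_right_mono) auto
    ultimately show ?thesis
      unfolding s_def[symmetric] e1_def[symmetric] by (simp add: algebra_simps)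
  qed
  have Pq: "Pq (x - xs) - Pq (x' - xs) = (x - xs) \<bullet> (P i *v (x - xs)) - (x' - xs) \<bullet> (P i *v (x' - xs))"
    by (rule Pq_diff[OF i]) (simp add: update_eq)
  show ?thesis
    using update_bound G desc split young lin P
    unfolding Pq gap_def Hb_def \<delta>_def[symmetric] a_def[symmetric] by (simp add: field_simps)
qed

end

section \<open>The random iteration\<close>

text \<open>Choosing a representative for each key makes \<open>h\<close> a function of
  \<open>key\<close> on \<open>S\<close>. It serves to show that finitely much information
  determines an iterate.\<close>

lemma finite_image_factor:
  assumes "finite (key ` S)"
    and "\<And>v w. v \<in> S \<Longrightarrow> w \<in> S \<Longrightarrow> key v = key w \<Longrightarrow> h v = h w"
  shows "finite (h ` S)"
proof -
  have "h ` S \<subseteq> (\<lambda>c. h (SOME w. w \<in> S \<and> key w = c)) ` key ` S"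
  proof
    fix y assume "y \<in> h ` S"
    then obtain w where w: "w \<in> S" "y = h w" by auto
    define v where "v = (SOME v. v \<in> S \<and> key v = key w)"
    have "v \<in> S \<and> key v = key w" unfolding v_def by (rule someI[of _ w]) (simp add: w)
    then have "y = h v" using assms(2)[of v w] w by auto
    then show "y \<in> (\<lambda>c. h (SOME w. w \<in> S \<and> key w = c)) ` key ` S"
      using w(1) by (auto simp: v_def)
  qed
  then show ?thesis using assms(1) by (meson finite_imageI finite_subset)
qed

lemma (in finite_measure) integrable_simple_real:
  fixes h :: "'a \<Rightarrow> real"
  assumes "simple_function M h"
  shows "integrable M h"
  by (rule integrable_simple_function[OF assms]) (simp add: emeasure_eq_measure)

text \<open>Each minimiser is inserted as competitor in the variational inequality of the other. On
  adding, everything cancels except the form of \<open>P i\<close> at their difference.\<close>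

lemma (in block_step) unique:
  assumes "block_step blk m f gradf g A b L Lr P \<beta> \<rho> \<alpha> \<tau> xs lams Lc i x y xh \<mu>"
  shows "x' = y"
proof -
  interpret Y: block_step blk m f gradf g A b L Lr P \<beta> \<rho> \<alpha> \<tau> xs lams Lc i x y xh \<mu>
    by (rule assms)
  have "gr i x' - gr i y \<le> U i (gradf xh - transpose A *v \<mu>) \<bullet> (y - x') + (y - x') \<bullet> (P i *v (x' - x))"
    by (rule variational_inequality(2)) (simp_all add: Y.other Y.g_update_finite)
  moreover have "gr i y - gr i x' \<le> U i (gradf xh - transpose A *v \<mu>) \<bullet> (x' - y) + (x' - y) \<bullet> (P i *v (y - x))"
    by (rule Y.variational_inequality(2)) (simp_all add: other g_update_finite)
  ultimately have "(x' - y) \<bullet> (P i *v (x' - y)) \<le> 0"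
    by (simp add: inner_diff_left inner_diff_right matrix_vector_mult_diff_distrib)
  then have "U i (x' - y) = 0" by (rule P_form_pos[OF i])
  moreover have "U i (x' - y) = x' - y"
    unfolding Ublk_eq_self_iff by (simp add: other Y.other)
  ultimately show ?thesis by simp
qed

context block_problem
begin

text \<open>Here \<open>u\<close> is the current multiplier minus \<open>l\<close>, so
  \<open>u - \<rho> *\<^sub>R r'\<close> and \<open>u + \<rho> *\<^sub>R r\<close> belong to the
  next and the previous one. All terms in \<open>r'\<close> cancel, and the two sides differ by
  \<open>(\<beta> / m - \<rho>) * (norm r)\<^sup>2\<close>.\<close>

lemma dual_step:
  fixes u r r' l :: "real^'q"
  defines "\<mu> \<equiv> u + l - \<beta> *\<^sub>R r"
  shows "\<mu> \<bullet> (r' - r) - \<beta> / 2 * (norm (r' - r))\<^sup>2 - l \<bullet> r'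
      + ((norm (u - \<rho> *\<^sub>R r'))\<^sup>2 - (1 - 1 / m) * (norm u)\<^sup>2) / (2 * \<rho>) + (\<beta> - \<rho>) / 2 * (norm r')\<^sup>2
    \<le> - (1 - 1 / m) * (l \<bullet> r)
      + ((norm u)\<^sup>2 - (1 - 1 / m) * (norm (u + \<rho> *\<^sub>R r))\<^sup>2) / (2 * \<rho>) + (\<beta> - \<rho>) / 2 * (norm r)\<^sup>2
      - \<rho> / (2 * m) * (norm r)\<^sup>2 - (\<mu> \<bullet> r) / m"
proof -
  define c where "c = 1 / real m"
  define N where "N = (norm u)\<^sup>2 / (2 * \<rho>)"
  have e1: "((norm (u - \<rho> *\<^sub>R r'))\<^sup>2 - (1 - c) * (norm u)\<^sup>2) / (2 * \<rho>)
      = c * N - u \<bullet> r' + \<rho> / 2 * (r' \<bullet> r')"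
    using \<rho>_pos unfolding N_def power2_norm_eq_inner
    by (simp add: inner_diff_left inner_diff_right inner_commute[of r' u] field_simps power2_eq_square)
  have e2: "((norm u)\<^sup>2 - (1 - c) * (norm (u + \<rho> *\<^sub>R r))\<^sup>2) / (2 * \<rho>)
      = c * N - (1 - c) * (u \<bullet> r) - (1 - c) * \<rho> / 2 * (r \<bullet> r)"
    using \<rho>_pos unfolding N_def power2_norm_eq_inner
    by (simp add: inner_add_left inner_add_right inner_commute[of r u] field_simps power2_eq_square)
  have le: "\<rho> * (r \<bullet> r) \<le> \<beta> * c * (r \<bullet> r)"
    using \<rho>_le by (intro mult_right_mono) (auto simp: c_def)
  have e3: "\<rho> / (2 * m) = \<rho> * c / 2" "y / real m = c * y" for y
    by (simp_all add: c_def)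
  have e4: "(norm (r' - r))\<^sup>2 = r' \<bullet> r' - 2 * (r \<bullet> r') + r \<bullet> r"
    unfolding power2_norm_eq_inner by (simp add: inner_diff_left inner_diff_right inner_commute[of r' r])
  have e5: "\<mu> \<bullet> z = u \<bullet> z + l \<bullet> z - \<beta> * (r \<bullet> z)" for z
    by (simp add: \<mu>_def inner_diff_left inner_add_left)
  show ?thesis
    unfolding e3 mult_1_right e1 e2 e4 e5 power2_norm_eq_inner[of r] power2_norm_eq_inner[of r']
    using le by (simp add: inner_diff_right algebra_simps diff_divide_distrib)
qed

text \<open>Multiplied by \<open>2 \<rho> m\<close>, the right-hand side is at least the square of
  \<open>norm (u - ((m - 1) * \<rho>) *\<^sub>R r)\<close>, because
  \<open>\<rho> \<le> \<beta> / m\<close>.\<close>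

lemma dual_energy_nonneg:
  fixes u r :: "real^'q"
  shows "0 \<le> ((norm u)\<^sup>2 - (1 - 1 / m) * (norm (u + \<rho> *\<^sub>R r))\<^sup>2) / (2 * \<rho>) + (\<beta> - \<rho>) / 2 * (norm r)\<^sup>2"
    (is "0 \<le> ?e")
proof -
  define n where "n = real m - 1"
  have mn: "real m = n + 1" "n \<ge> 0" using m_pos by (auto simp: n_def)
  have "0 \<le> (norm (u - (n * \<rho>) *\<^sub>R r))\<^sup>2" by simp
  also have "\<dots> = (norm u)\<^sup>2 - 2 * n * \<rho> * (u \<bullet> r) + n\<^sup>2 * \<rho>\<^sup>2 * (norm r)\<^sup>2"
    unfolding power2_norm_eq_inner
    by (simp add: inner_diff_left inner_diff_right inner_commute[of r u] field_simps power2_eq_square)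
  also have "\<dots> = m * (norm u)\<^sup>2 - n * (norm (u + \<rho> *\<^sub>R r))\<^sup>2 + \<rho> * (n * (m * \<rho>)) * (norm r)\<^sup>2"
    unfolding power2_norm_eq_inner mn(1)
    by (simp add: inner_add_left inner_add_right inner_commute[of r u] field_simps power2_eq_square)
  also have "\<dots> \<le> m * (norm u)\<^sup>2 - n * (norm (u + \<rho> *\<^sub>R r))\<^sup>2 + \<rho> * (m * (\<beta> - \<rho>)) * (norm r)\<^sup>2"
  proof -
    have "m * \<rho> \<le> \<beta>" using \<rho>_le m_real_pos by (simp add: field_simps)
    then have "n * \<rho> \<le> \<beta> - \<rho>" by (simp add: mn(1) algebra_simps)
    then have "n * (m * \<rho>) \<le> m * (\<beta> - \<rho>)"
      using mult_left_mono[of "n * \<rho>" "\<beta> - \<rho>" "real m"] by (simp add: mult_ac)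
    then show ?thesis using \<rho>_pos by (intro add_left_mono mult_right_mono mult_left_mono) auto
  qed
  also have "\<dots> = 2 * \<rho> * m * ?e"
    using \<rho>_pos m_pos by (simp add: n_def field_simps power2_eq_square)
  finally have "0 \<le> 2 * \<rho> * m * ?e" .
  moreover have "2 * \<rho> * m > 0" using \<rho>_pos m_real_pos by simp
  ultimately show ?thesis by (metis zero_le_mult_iff not_le)
qed

end

text \<open>\<open>Fl k\<close> is the history before iteration \<open>k\<close>, which is why
  \<open>ik k\<close> is measurable only for \<open>Fl (Suc k)\<close>. The truncated subtraction in
  the delay window encodes that increments at negative times vanish.\<close>

locale async_iteration = prob_space M + block_problem blk m f gradf g A b L Lr P \<beta> \<rho> \<alpha> \<tau> xs lams Lc
  for M :: "'w measure" and blk :: "'n::finite \<Rightarrow> nat" and m f gradf g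
    and A :: "real^'n^'q::finite" and b L Lr P \<beta> \<rho> \<alpha> \<tau> xs lams Lc +
  fixes Fl :: "nat \<Rightarrow> 'w measure"
    and x0 :: "real^'n"
    and ik :: "nat \<Rightarrow> 'w \<Rightarrow> nat"
    and x xhat :: "nat \<Rightarrow> 'w \<Rightarrow> real^'n"
    and r lam :: "nat \<Rightarrow> 'w \<Rightarrow> real^'q"
  assumes Fl_sub: "\<And>k. subalgebra M (Fl k)"
    and Fl_mono: "\<And>k. sets (Fl k) \<subseteq> sets (Fl (Suc k))"
    and x_meas: "\<And>k. x k \<in> borel_measurable (Fl k)"
    and xhat_meas: "\<And>k. xhat k \<in> borel_measurable (Fl k)"
    and ik_meas: "\<And>k. ik k \<in> measurable (Fl (Suc k)) (count_space UNIV)"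
    and ik_unif: "\<And>k i E. i < m \<Longrightarrow> E \<in> sets (Fl k) \<Longrightarrow>
        measure M (E \<inter> {w \<in> space M. ik k w = i}) = measure M E / real m"
    and delay: "\<And>k w. w \<in> space M \<Longrightarrow> \<exists>J. J \<subseteq> {k - \<tau>..<k} \<and>
        xhat k w = x k w + (\<Sum>d\<in>J. x d w - x (Suc d) w)"
    and x_init: "\<And>w. w \<in> space M \<Longrightarrow> x 0 w = x0"
    and r_init: "\<And>w. w \<in> space M \<Longrightarrow> r 0 w = A *v x0 - b"
    and lam_init: "\<And>w. w \<in> space M \<Longrightarrow> lam 0 w = 0"
    and x_other: "\<And>k w j. w \<in> space M \<Longrightarrow> blk j \<noteq> ik k w \<Longrightarrow> x (Suc k) w $ j = x k w $ j"
    and x_argmin: "\<And>k w z. w \<in> space M \<Longrightarrow> (\<And>j. blk j \<noteq> ik k w \<Longrightarrow> z $ j = x k w $ j) \<Longrightarrow>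
        ereal ((Ublk blk (ik k w) (gradf (xhat k w)
                  - transpose A *v (lam k w - \<beta> *\<^sub>R r k w))) \<bullet> x (Suc k) w
               + (1/2) * ((x (Suc k) w - x k w) \<bullet> (P (ik k w) *v (x (Suc k) w - x k w))))
          + g (ik k w) (x (Suc k) w)
        \<le> ereal ((Ublk blk (ik k w) (gradf (xhat k w)
                  - transpose A *v (lam k w - \<beta> *\<^sub>R r k w))) \<bullet> z
               + (1/2) * ((z - x k w) \<bullet> (P (ik k w) *v (z - x k w))))
          + g (ik k w) z"
    and r_step: "\<And>k w. w \<in> space M \<Longrightarrow> r (Suc k) w = r k w + A *v (Ublk blk (ik k w) (x (Suc k) w - x k w))"
    and lam_step: "\<And>k w. w \<in> space M \<Longrightarrow> lam (Suc k) w = lam k w - \<rho> *\<^sub>R r (Suc k) w"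
begin

section \<open>Pathwise relations and finiteness of the ranges\<close>

lemma update_supported: "w \<in> space M \<Longrightarrow> U (ik k w) (x (Suc k) w - x k w) = x (Suc k) w - x k w"
  unfolding Ublk_eq_self_iff by (simp add: x_other)

text \<open>Indices outside the range are excluded only almost surely; such an index owns no
  coordinate, so the iterate stays put.\<close>

lemma no_update: "w \<in> space M \<Longrightarrow> \<not> ik k w < m \<Longrightarrow> x (Suc k) w = x k w"
  using x_other blk_range by (metis vec_eq_iff)

lemma single_block_update: "w \<in> space M \<Longrightarrow> single_block (x (Suc k) w - x k w)"
proof (cases "ik k w < m")
  case True
  then show "w \<in> space M \<Longrightarrow> ?thesis" using update_supported by (auto simp: single_block_def)
next
  case False
  moreover have "single_block 0"
    using m_pos linear_0[OF linear_Ublk, of blk] unfolding single_block_def by (intro exI[of _ 0]) auto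
  ultimately show "w \<in> space M \<Longrightarrow> ?thesis" by (simp add: no_update)
qed

lemma r_eq: "w \<in> space M \<Longrightarrow> r k w = A *v x k w - b"
  by (induction k) (auto simp: r_init x_init r_step update_supported matrix_vector_mult_diff_distrib)

lemma lam_eq: "w \<in> space M \<Longrightarrow> lam k w = - (\<Sum>t<k. \<rho> *\<^sub>R r (Suc t) w)"
  by (induction k) (auto simp: lam_init lam_step)

lemma block_step_at:
  assumes "w \<in> space M" "ik k w < m"
  shows "block_step blk m f gradf g A b L Lr P \<beta> \<rho> \<alpha> \<tau> xs lams Lc
    (ik k w) (x k w) (x (Suc k) w) (xhat k w) (lam k w - \<beta> *\<^sub>R r k w)"
  by unfold_locales (use assms x_other x_argmin in auto)

text \<open>By uniqueness of the update, the next iterate is a function of the earlier iterates, the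
  set of missed increments and the chosen block, each ranging over a finite set.\<close>

lemma finite_range_x: "finite (x k ` space M)"
proof (induction k rule: less_induct)
  case (less k)
  show ?case
  proof (cases k)
    case 0
    have "x 0 ` space M \<subseteq> {x0}" using x_init by auto
    then show ?thesis using 0 finite_subset by auto
  next
    case (Suc n)
    define hist where "hist w = restrict (\<lambda>d. x d w) {..n}" for w
    have "hist ` space M \<subseteq> Pi\<^sub>E {..n} (\<lambda>d. x d ` space M)"
      by (auto simp: hist_def split: if_splits)
    moreover have "finite (Pi\<^sub>E {..n} (\<lambda>d. x d ` space M))"
      using less.IH Suc by (intro finite_PiE) auto
    ultimately have fin_hist: "finite (hist ` space M)" by (rule finite_subset)
    define J where "J w = (SOME J. J \<subseteq> {n - \<tau>..<n} \<and>
        xhat n w = x n w + (\<Sum>d\<in>J. x d w - x (Suc d) w))" for w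
    have J: "J w \<subseteq> {n - \<tau>..<n}" "xhat n w = x n w + (\<Sum>d\<in>J w. x d w - x (Suc d) w)"
      if "w \<in> space M" for w
      using someI_ex[OF delay[OF that, of n]] unfolding J_def by auto
    \<comment> \<open>The minimum with \<open>m\<close> merges all indices outside the range; each
      of them leaves the iterate unchanged.\<close>
    define key where "key w = (hist w, J w, min (ik n w) m)" for w
    have "key ` space M \<subseteq> hist ` space M \<times> Pow {n - \<tau>..<n} \<times> {..m}"
      using J(1) by (auto simp: key_def)
    then have "finite (key ` space M)"
      by (rule finite_subset) (use fin_hist in auto)
    then have "finite (x (Suc n) ` space M)"
    proof (rule finite_image_factor)
      fix v w
      assume v: "v \<in> space M" and w: "w \<in> space M" and "key v = key w"
      then have eq: "hist v = hist w" "J v = J w" "min (ik n v) m = min (ik n w) m"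
        by (auto simp: key_def)
      have x_eq: "x d v = x d w" if "d \<le> n" for d
        using fun_cong[OF eq(1), of d] that by (simp add: hist_def)
      have "(\<Sum>d\<in>J v. x d v - x (Suc d) v) = (\<Sum>d\<in>J w. x d w - x (Suc d) w)"
        using J(1)[OF v] eq(2) by (intro sum.cong) (auto simp: x_eq subset_eq Suc_leI)
      then have xhat_eq: "xhat n v = xhat n w" using J(2) v w x_eq[of n] by simp
      have r_eq': "r d v = r d w" if "d \<le> n" for d using that v w by (simp add: r_eq x_eq)
      then have lam_eq': "lam n v = lam n w" using v w by (simp add: lam_eq)
      show "x (Suc n) v = x (Suc n) w"
      proof (cases "ik n w < m")
        case True
        then have ik: "ik n v = ik n w" using eq(3) by (simp add: min_def split: if_splits)
        show ?thesis
          using block_step_at[OF v, of n] block_step_at[OF w, of n] True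
            x_eq[of n] xhat_eq r_eq'[of n] lam_eq' ik
          by (auto intro: block_step.unique)
      next
        case False
        then have "\<not> ik n v < m" using eq(3) by (simp add: min_def split: if_splits)
        then show ?thesis using False v w no_update x_eq[of n] by simp
      qed
    qed
    then show ?thesis by (simp add: Suc)
  qed
qed

lemma finite_range_xhat: "finite (xhat k ` space M)"
proof -
  have "xhat k ` space M \<subseteq> (\<lambda>(J, h). h k + (\<Sum>d\<in>J. h d - h (Suc d)))
      ` (Pow {k - \<tau>..<k} \<times> Pi\<^sub>E {..k} (\<lambda>d. x d ` space M))"
  proof (rule image_subsetI)
    fix w assume w: "w \<in> space M"
    obtain J where J: "J \<subseteq> {k - \<tau>..<k}" "xhat k w = x k w + (\<Sum>d\<in>J. x d w - x (Suc d) w)"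
      using delay[OF w] by blast
    define h where "h = restrict (\<lambda>d. x d w) {..k}"
    have "(\<Sum>d\<in>J. x d w - x (Suc d) w) = (\<Sum>d\<in>J. h d - h (Suc d))"
      using J(1) by (intro sum.cong) (auto simp: h_def subset_eq Suc_leI)
    then have "xhat k w = h k + (\<Sum>d\<in>J. h d - h (Suc d))" using J(2) by (simp add: h_def)
    moreover have "h \<in> Pi\<^sub>E {..k} (\<lambda>d. x d ` space M)" using w by (auto simp: h_def)
    ultimately show "xhat k w \<in> (\<lambda>(J, h). h k + (\<Sum>d\<in>J. h d - h (Suc d)))
      ` (Pow {k - \<tau>..<k} \<times> Pi\<^sub>E {..k} (\<lambda>d. x d ` space M))"
      using J(1) by (intro image_eqI[of _ _ "(J, h)"]) auto
  qed
  moreover have "finite (Pow {k - \<tau>..<k} \<times> Pi\<^sub>E {..k} (\<lambda>d. x d ` space M))"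
    by (auto intro!: finite_PiE finite_range_x)
  ultimately show ?thesis by (meson finite_imageI finite_subset)
qed

section \<open>Measurability with respect to the history\<close>

lemma space_Fl: "space (Fl k) = space M"
  using Fl_sub by (simp add: subalgebra_def)

lemma sets_Fl_M: "E \<in> sets (Fl k) \<Longrightarrow> E \<in> sets M"
  using Fl_sub[of k] by (auto simp: subalgebra_def)

lemma sets_Fl_mono: "k \<le> n \<Longrightarrow> sets (Fl k) \<subseteq> sets (Fl n)"
  using Fl_mono by (rule lift_Suc_mono_le)

lemma simple_Fl_mono: "simple_function (Fl k) h \<Longrightarrow> k \<le> n \<Longrightarrow> simple_function (Fl n) h"
  using sets_Fl_mono[of k n] by (auto simp: simple_function_def space_Fl)

lemma simple_Fl_M: "simple_function (Fl k) h \<Longrightarrow> simple_function M h"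
  by (auto simp: simple_function_def space_Fl sets_Fl_M)

lemma simple_x: "simple_function (Fl k) (x k)"
  by (rule simple_function_borel_measurable) (simp_all add: x_meas space_Fl finite_range_x)

lemma simple_xhat: "simple_function (Fl k) (xhat k)"
  by (rule simple_function_borel_measurable) (simp_all add: xhat_meas space_Fl finite_range_xhat)

lemma simple_r: "simple_function (Fl k) (r k)"
proof -
  have "simple_function (Fl k) (\<lambda>w. A *v x k w - b)"
    by (rule simple_function_compose1[OF simple_x])
  then show ?thesis
    by (rule simple_function_cong[THEN iffD1, rotated]) (simp add: r_eq space_Fl)
qed

lemma simple_lam: "simple_function (Fl k) (lam k)"
proof -
  have "simple_function (Fl k) (\<lambda>w. \<Sum>t<k. \<rho> *\<^sub>R r (Suc t) w)"
    by (intro simple_function_sum simple_function_compose1[OF simple_Fl_mono[OF simple_r]]) auto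
  then have "simple_function (Fl k) (\<lambda>w. - (\<Sum>t<k. \<rho> *\<^sub>R r (Suc t) w))"
    by (rule simple_function_compose1)
  then show ?thesis
    by (rule simple_function_cong[THEN iffD1, rotated]) (simp add: lam_eq space_Fl)
qed

lemma sets_ik: "{w \<in> space M. ik k w = i} \<in> sets M"
proof -
  have "ik k -` {i} \<inter> space (Fl (Suc k)) \<in> sets (Fl (Suc k))"
    by (rule measurable_sets[OF ik_meas]) simp
  then have "ik k -` {i} \<inter> space M \<in> sets M" by (simp add: space_Fl sets_Fl_M)
  then show ?thesis by (simp add: vimage_def Int_def conj_commute)
qed

lemma AE_ik_less: "AE w in M. ik k w < m"
proof -
  have "{w \<in> space M. ik k w < m} = (\<Union>i<m. {w \<in> space M. ik k w = i})" by auto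
  then have "prob {w \<in> space M. ik k w < m} = (\<Sum>i<m. prob {w \<in> space M. ik k w = i})"
    by (simp only:) (intro finite_measure_finite_Union,
      auto simp: sets_ik disjoint_family_on_def)
  also have "\<dots> = (\<Sum>i<m. 1 / real m)"
  proof (rule sum.cong)
    fix i assume "i \<in> {..<m}"
    moreover have "space M \<in> sets (Fl k)" by (metis sets.top space_Fl)
    moreover have "space M \<inter> {w \<in> space M. ik k w = i} = {w \<in> space M. ik k w = i}" by auto
    ultimately show "prob {w \<in> space M. ik k w = i} = 1 / real m"
      using ik_unif[of i "space M" k] by (simp add: prob_space)
  qed simp
  also have "\<dots> = 1" using m_pos by simp
  finally have "AE w in M. w \<in> {w \<in> space M. ik k w < m}" by (rule AE_prob_1)
  then show ?thesis by eventually_elim simp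
qed

text \<open>Conditional uniformity of the block, passed from events of the history to simple
  functions by linearity over the level sets. It takes the place of conditional
  expectations.\<close>

lemma expectation_block_indicator:
  fixes h :: "'w \<Rightarrow> real"
  assumes h: "simple_function (Fl k) h" and i: "i < m"
  shows "(\<integral>w. h w * indicator {w \<in> space M. ik k w = i} w \<partial>M) = (\<integral>w. h w \<partial>M) / m"
proof -
  let ?B = "{w \<in> space M. ik k w = i}"
  define V where "V y = h -` {y} \<inter> space M" for y
  have V: "V y \<in> sets (Fl k)" for y
    using simple_functionD(2)[OF h, of "{y}"] by (simp add: V_def space_Fl)
  have VM: "V y \<in> sets M" for y using V sets_Fl_M by blast
  have fin: "finite (h ` space M)" using simple_functionD(1)[OF h] by (simp add: space_Fl)
  have rep: "h w = (\<Sum>y\<in>h ` space M. y * indicator (V y) w)" if "w \<in> space M" for w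
  proof -
    have "h w = (\<Sum>y\<in>h ` space (Fl k). indicator (h -` {y} \<inter> space (Fl k)) w *\<^sub>R y)"
      by (rule simple_function_indicator_representation_banach[OF h]) (simp add: space_Fl that)
    also have "\<dots> = (\<Sum>y\<in>h ` space M. y * indicator (V y) w)"
      unfolding V_def space_Fl by (rule sum.cong) simp_all
    finally show ?thesis .
  qed
  have "(\<integral>w. h w * indicator ?B w \<partial>M) = (\<integral>w. (\<Sum>y\<in>h ` space M. y * indicator (V y \<inter> ?B) w) \<partial>M)"
  proof (rule Bochner_Integration.integral_cong)
    fix w assume w: "w \<in> space M"
    show "h w * indicator ?B w = (\<Sum>y\<in>h ` space M. y * indicator (V y \<inter> ?B) w)"
      by (subst rep[OF w]) (simp add: sum_distrib_right indicator_inter_arith mult.assoc)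
  qed simp
  also have "\<dots> = (\<Sum>y\<in>h ` space M. y * prob (V y \<inter> ?B))"
    using fin VM sets_ik by (subst Bochner_Integration.integral_sum) (auto simp: less_top[symmetric])
  also have "\<dots> = (\<Sum>y\<in>h ` space M. y * prob (V y)) / m"
    unfolding sum_divide_distrib using ik_unif[OF i V] by (intro sum.cong) auto
  also have "(\<Sum>y\<in>h ` space M. y * prob (V y)) = (\<integral>w. (\<Sum>y\<in>h ` space M. y * indicator (V y) w) \<partial>M)"
    using fin VM by (subst Bochner_Integration.integral_sum) (auto simp: less_top[symmetric])
  also have "\<dots> = (\<integral>w. h w \<partial>M)"
    by (rule Bochner_Integration.integral_cong[OF refl rep[symmetric]])
  finally show ?thesis .
qed

end

section \<open>The Lyapunov function\<close>

context async_iteration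
begin

text \<open>This is \<Phi> at the iterate, the solution and its multiplier, since
  \<open>r k w\<close> equals \<open>A *v x k w - b\<close>.\<close>

definition Phi :: "nat \<Rightarrow> 'w \<Rightarrow> real" where
  "Phi k w = gap (x k w) - lams \<bullet> r k w"

definition decrease :: "nat \<Rightarrow> 'w \<Rightarrow> real" where
  "decrease k w = Phi k w / m + \<rho> / (2 * m) * (norm (r k w))\<^sup>2"

definition dw :: "nat \<Rightarrow> 'w \<Rightarrow> real" where
  "dw d w = delay_weight (x (Suc d) w - x d w)"

text \<open>The truncated subtraction makes the weight of every step older than \<open>\<tau>\<close> vanish.\<close>

definition delay_energy :: "nat \<Rightarrow> 'w \<Rightarrow> real" where
  "delay_energy k w = (\<Sum>d<k. real (d + \<tau> + 1 - k) * dw d w)"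

text \<open>The time shift makes the previous multiplier \<open>lam n\<close> available; the two
  middle lines are the dual energy of \<open>dual_energy_nonneg\<close>.\<close>

definition lyap :: "nat \<Rightarrow> 'w \<Rightarrow> real" where
  "lyap n w = Phi (Suc n) w
     + ((norm (lam (Suc n) w - lams))\<^sup>2 - (1 - 1 / m) * (norm (lam n w - lams))\<^sup>2) / (2 * \<rho>)
     + (\<beta> - \<rho>) / 2 * (norm (r (Suc n) w))\<^sup>2
     + Pq (x (Suc n) w - xs) / 2 + delay_energy (Suc n) w"

definition block_gain :: "nat \<Rightarrow> nat \<Rightarrow> 'w \<Rightarrow> real" where
  "block_gain k i w = Hb (x k w) (xhat k w) (lam k w - \<beta> *\<^sub>R r k w) i"

section \<open>One step of the Lyapunov function\<close>

lemma dw_nonneg: "dw d w \<ge> 0"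
  by (simp add: dw_def delay_weight_nonneg)

lemma delay_energy_nonneg: "delay_energy k w \<ge> 0"
  unfolding delay_energy_def by (intro sum_nonneg) (simp add: dw_nonneg)

text \<open>A new step enters with weight \<tau> and loses one unit each time a delay window
  contains it, which is exactly the price charged there.\<close>

lemma delay_energy_Suc:
  "delay_energy (Suc k) w = delay_energy k w + \<tau> * dw k w - (\<Sum>d\<in>{k - \<tau>..<k}. dw d w)"
proof -
  have "(\<Sum>d\<in>{k - \<tau>..<k}. dw d w) = (\<Sum>d<k. if k - \<tau> \<le> d then dw d w else 0)"
    by (subst sum.inter_filter[symmetric]) (auto intro!: sum.cong)
  then have "delay_energy k w - (\<Sum>d\<in>{k - \<tau>..<k}. dw d w)
      = (\<Sum>d<k. real (d + \<tau> + 1 - k) * dw d w - (if k - \<tau> \<le> d then dw d w else 0))"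
    by (simp add: delay_energy_def sum_subtractf)
  also have "\<dots> = (\<Sum>d<k. real (d + \<tau> - k) * dw d w)"
  proof (rule sum.cong)
    fix d assume "d \<in> {..<k}"
    \<comment> \<open>For \<open>d < k - \<tau>\<close> both truncated differences are 0.\<close>
    have "real (d + \<tau> + 1 - k) = real (d + \<tau> - k) + (if k - \<tau> \<le> d then 1 else 0)" by auto
    then show "real (d + \<tau> + 1 - k) * dw d w - (if k - \<tau> \<le> d then dw d w else 0)
        = real (d + \<tau> - k) * dw d w"
      by (auto simp: algebra_simps)
  qed simp
  finally show ?thesis by (simp add: delay_energy_def)
qed

lemma lam_prev: "w \<in> space M \<Longrightarrow> lam n w - lams = (lam (Suc n) w - lams) + \<rho> *\<^sub>R r (Suc n) w"
  by (simp add: lam_step)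

lemma sum_block_gain_le:
  assumes w: "w \<in> space M"
  shows "(\<Sum>i<m. block_gain k i w) / m \<le> - gap (x k w) / m
    + ((lam k w - \<beta> *\<^sub>R r k w) \<bullet> r k w) / m + (\<Sum>d\<in>{k - \<tau>..<k}. dw d w)"
proof -
  obtain J where J: "J \<subseteq> {k - \<tau>..<k}" "xhat k w = x k w + (\<Sum>d\<in>J. x d w - x (Suc d) w)"
    using delay[OF w] by blast
  have "(\<Sum>d\<in>J. x d w - x (Suc d) w) = - (\<Sum>d\<in>J. x (Suc d) w - x d w)"
    by (simp add: sum_subtractf)
  then have "x k w = xhat k w + (\<Sum>d\<in>J. x (Suc d) w - x d w)"
    using J(2) by simp
  then have "(\<Sum>i<m. block_gain k i w) \<le> - gap (x k w) + (lam k w - \<beta> *\<^sub>R r k w) \<bullet> (A *v x k w - b)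
      + m * (\<Sum>d\<in>{k - \<tau>..<k}. dw d w)"
    unfolding block_gain_def dw_def
    by (intro sum_Hb_le[OF J(1)]) (auto simp: single_block_update[OF w])
  then show ?thesis
    using m_real_pos by (simp add: r_eq[OF w] field_simps)
qed

text \<open>The block average is subtracted from the block gain and added again. Its bound supplies
  \<open>- gap / m\<close>, a window sum cancelled by \<open>delay_energy_Suc\<close>, and
  \<open>(\<mu> \<bullet> r k w) / m\<close>, cancelled by \<open>dual_step\<close>.\<close>

lemma lyap_step:
  assumes w: "w \<in> space M" and ik: "ik (Suc n) w < m"
  shows "lyap (Suc n) w \<le> lyap n w - decrease (Suc n) w
    + (block_gain (Suc n) (ik (Suc n) w) w - (\<Sum>i<m. block_gain (Suc n) i w) / m)"
proof -
  define k where "k = Suc n"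
  define u where "u = lam k w - lams"
  define \<mu> where "\<mu> = u + lams - \<beta> *\<^sub>R r k w"
  have \<mu>: "lam k w - \<beta> *\<^sub>R r k w = \<mu>" by (simp add: \<mu>_def u_def)
  interpret S: block_step blk m f gradf g A b L Lr P \<beta> \<rho> \<alpha> \<tau> xs lams Lc
    "ik k w" "x k w" "x (Suc k) w" "xhat k w" \<mu>
    using block_step_at[OF w, of k] ik by (simp add: k_def[symmetric] \<mu>)
  have dr: "A *v (x (Suc k) w - x k w) = r (Suc k) w - r k w"
    by (simp add: r_eq[OF w] matrix_vector_mult_diff_distrib)
  have gap': "gap (x (Suc k) w) \<le> gap (x k w) + block_gain k (ik k w) w + \<mu> \<bullet> (r (Suc k) w - r k w)
      + (Pq (x k w - xs) - Pq (x (Suc k) w - xs)) / 2 - \<tau> * dw k w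
      - \<beta> / 2 * (norm (r (Suc k) w - r k w))\<^sup>2"
    using S.gap_step unfolding dr block_gain_def \<mu> dw_def .
  have avg: "(\<Sum>i<m. block_gain k i w) / m \<le> - gap (x k w) / m + (\<mu> \<bullet> r k w) / m
      + (\<Sum>d\<in>{k - \<tau>..<k}. dw d w)"
    using sum_block_gain_le[OF w, of k] unfolding \<mu> .
  have un: "lam n w - lams = u + \<rho> *\<^sub>R r k w" "lam (Suc k) w - lams = u - \<rho> *\<^sub>R r (Suc k) w"
    using lam_prev[OF w, of n] by (simp_all add: u_def k_def lam_step[OF w])
  have dual: "\<mu> \<bullet> (r (Suc k) w - r k w) - \<beta> / 2 * (norm (r (Suc k) w - r k w))\<^sup>2 - lams \<bullet> r (Suc k) w
      + ((norm (lam (Suc k) w - lams))\<^sup>2 - (1 - 1 / m) * (norm (lam k w - lams))\<^sup>2) / (2 * \<rho>)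
      + (\<beta> - \<rho>) / 2 * (norm (r (Suc k) w))\<^sup>2
    \<le> - (1 - 1 / m) * (lams \<bullet> r k w)
      + ((norm (lam k w - lams))\<^sup>2 - (1 - 1 / m) * (norm (lam n w - lams))\<^sup>2) / (2 * \<rho>)
      + (\<beta> - \<rho>) / 2 * (norm (r k w))\<^sup>2
      - \<rho> / (2 * m) * (norm (r k w))\<^sup>2 - (\<mu> \<bullet> r k w) / m"
    unfolding un u_def[symmetric] \<mu>_def by (rule dual_step)
  have dec: "decrease k w = gap (x k w) / m - (lams \<bullet> r k w) / m + \<rho> / (2 * m) * (norm (r k w))\<^sup>2"
    by (simp add: decrease_def Phi_def diff_divide_distrib)
  have "- (1 - 1 / m) * (lams \<bullet> r k w) = - (lams \<bullet> r k w) + (lams \<bullet> r k w) / m"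
    by (simp add: algebra_simps)
  then show ?thesis
    using gap' avg dual dec delay_energy_Suc[of k w]
    unfolding lyap_def k_def[symmetric] Phi_def by (simp add: diff_divide_distrib)
qed

section \<open>The event that an iterate lies in the domain of the objective\<close>

definition dom_event :: "nat \<Rightarrow> 'w set" where
  "dom_event N = {w \<in> space M. \<forall>i<m. g i (x N w) \<noteq> \<infinity>}"

text \<open>A selected block lands in its domain, so an infinite value can only be inherited by a
  block that was not selected.\<close>

lemma g_infinite_Suc:
  assumes w: "w \<in> space M" and i: "i < m" and inf: "g i (x (Suc k) w) = \<infinity>"
  shows "g i (x k w) = \<infinity>" "ik k w \<noteq> i"
proof -
  show ne: "ik k w \<noteq> i"
    using block_step.g_update_finite[OF block_step_at[OF w, of k]] i inf by auto
  show "g i (x k w) = \<infinity>"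
    using g_block[OF i, of "x (Suc k) w" "x k w"] x_other[OF w] ne inf by auto
qed

lemma dom_event_mono: "N \<le> k \<Longrightarrow> dom_event N \<subseteq> dom_event k"
proof (rule lift_Suc_mono_le[of dom_event])
  show "dom_event n \<subseteq> dom_event (Suc n)" for n
    unfolding dom_event_def using g_infinite_Suc(1) by blast
qed

text \<open>Holds for arbitrary \<open>Q\<close>, since preimages of all sets under a simple
  function are measurable.\<close>

lemma sets_state: "{w \<in> space M. Q (x k w)} \<in> sets (Fl k)"
proof -
  have "x k -` {y. Q y} \<inter> space (Fl k) \<in> sets (Fl k)"
    by (rule simple_functionD(2)[OF simple_x])
  also have "x k -` {y. Q y} \<inter> space (Fl k) = {w \<in> space M. Q (x k w)}"
    unfolding space_Fl by blast
  finally show ?thesis .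
qed

lemma sets_dom_event: "dom_event N \<in> sets (Fl N)"
  unfolding dom_event_def by (rule sets_state)

text \<open>Block \<open>i\<close> must have been missed in each of the first \<open>N\<close>
  iterations, and each miss contributes a factor \<open>1 - 1 / m\<close>.\<close>

lemma prob_g_infinite_le:
  assumes i: "i < m"
  shows "prob {w \<in> space M. g i (x N w) = \<infinity>} \<le> (1 - 1 / m) ^ N"
proof (induction N)
  case (Suc N)
  let ?B = "\<lambda>N. {w \<in> space M. g i (x N w) = \<infinity>}"
  let ?I = "{w \<in> space M. ik N w = i}"
  have B: "?B N \<in> sets (Fl N)" by (rule sets_state)
  have "prob (?B (Suc N)) \<le> prob (?B N - ?B N \<inter> ?I)"
    using sets_Fl_M[OF B] sets_ik[of N i] g_infinite_Suc[OF _ i, of _ N]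
    by (intro finite_measure_mono) auto
  also have "\<dots> = prob (?B N) - prob (?B N \<inter> ?I)"
    using sets_Fl_M[OF B] sets_ik[of N i] by (intro finite_measure_Diff) auto
  also have "\<dots> = (1 - 1 / m) * prob (?B N)"
    by (simp add: ik_unif[OF i B] algebra_simps)
  also have "\<dots> \<le> (1 - 1 / m) * (1 - 1 / m) ^ N"
    using m_pos Suc.IH by (intro mult_left_mono) auto
  finally show ?case by simp
qed simp

lemma prob_dom_event_tendsto: "(\<lambda>N. prob (space M - dom_event N)) \<longlonglongrightarrow> 0"
proof (rule tendsto_sandwich[of "\<lambda>_. 0"])
  have "(\<lambda>N. (1 - 1 / real m) ^ N) \<longlonglongrightarrow> 0"
    using m_pos by (intro LIMSEQ_realpow_zero) auto
  then show "(\<lambda>N. real m * (1 - 1 / real m) ^ N) \<longlonglongrightarrow> 0"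
    by (rule tendsto_mult_right_zero)
  show "\<forall>\<^sub>F N in sequentially. prob (space M - dom_event N) \<le> real m * (1 - 1 / real m) ^ N"
  proof (rule always_eventually, rule allI)
    fix N
    let ?B = "\<lambda>i. {w \<in> space M. g i (x N w) = \<infinity>}"
    have B: "?B i \<in> sets M" for i by (rule sets_Fl_M[OF sets_state])
    have "space M - dom_event N = (\<Union>i<m. ?B i)" by (auto simp: dom_event_def)
    then have "prob (space M - dom_event N) \<le> (\<Sum>i<m. prob (?B i))"
      using B by (simp only:) (intro measure_UNION_le, auto)
    also have "\<dots> \<le> (\<Sum>i<m. (1 - 1 / real m) ^ N)"
      by (intro sum_mono) (simp add: prob_g_infinite_le)
    finally show "prob (space M - dom_event N) \<le> real m * (1 - 1 / real m) ^ N" by simp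
  qed
qed simp_all

section \<open>Nonnegativity and integrability\<close>

lemma Phi_nonneg: "w \<in> dom_event k \<Longrightarrow> Phi k w \<ge> 0"
  unfolding Phi_def using gap_ge[of "x k w"] by (auto simp: dom_event_def r_eq)

lemma decrease_nonneg: "w \<in> dom_event k \<Longrightarrow> decrease k w \<ge> 0"
  unfolding decrease_def using Phi_nonneg[of w k] \<rho>_pos by (intro add_nonneg_nonneg) simp_all

lemma lyap_nonneg:
  assumes "w \<in> dom_event (Suc n)"
  shows "lyap n w \<ge> 0"
proof -
  have w: "w \<in> space M" using assms by (simp add: dom_event_def)
  show ?thesis
    unfolding lyap_def lam_prev[OF w, of n]
    using dual_energy_nonneg[of "lam (Suc n) w - lams" "r (Suc n) w"] Phi_nonneg[OF assms]
      Pq_nonneg[of "x (Suc n) w - xs"] delay_energy_nonneg[of "Suc n" w]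
    by simp
qed

lemma simple_block_gain: "simple_function (Fl k) (block_gain k i)"
proof -
  have s: "simple_function (Fl k) (\<lambda>w. ((x k w, xhat k w), (lam k w, r k w)))"
    by (intro simple_function_Pair simple_x simple_xhat simple_lam simple_r)
  show ?thesis
    unfolding block_gain_def
    using simple_function_compose1[OF s,
        of "\<lambda>s. Hb (fst (fst s)) (snd (fst s)) (fst (snd s) - \<beta> *\<^sub>R snd (snd s)) i"]
    by simp
qed

lemma integrable_state: "integrable M (\<lambda>w. h (x k w) (r k w) (lam k w) :: real)"
proof -
  have s: "simple_function (Fl k) (\<lambda>w. (x k w, (r k w, lam k w)))"
    by (intro simple_function_Pair simple_x simple_lam simple_r)
  have "simple_function (Fl k) (\<lambda>w. h (x k w) (r k w) (lam k w))"
    using simple_function_compose1[OF s, of "\<lambda>s. h (fst s) (fst (snd s)) (snd (snd s))"] by simp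
  then show ?thesis by (intro integrable_simple_real simple_Fl_M)
qed

lemma integrable_dw: "integrable M (dw d)"
proof -
  have "simple_function M (\<lambda>w. delay_weight (x (Suc d) w - x d w))"
    by (rule simple_function_compose2) (rule simple_Fl_M[OF simple_x])+
  then show ?thesis unfolding dw_def by (rule integrable_simple_real)
qed

lemma integrable_decrease: "integrable M (decrease k)"
  unfolding decrease_def Phi_def
  by (rule integrable_state[of "\<lambda>x r l. (gap x - lams \<bullet> r) / m + \<rho> / (2 * m) * (norm r)\<^sup>2"])

lemma integrable_lyap: "integrable M (lyap n)"
  unfolding lyap_def Phi_def delay_energy_def
  using integrable_state[of "\<lambda>x r l. gap x" "Suc n"] integrable_state[of "\<lambda>x r l. lams \<bullet> r" "Suc n"]
    integrable_state[of "\<lambda>x r l. (norm (l - lams))\<^sup>2" "Suc n"]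
    integrable_state[of "\<lambda>x r l. (norm (l - lams))\<^sup>2" n]
    integrable_state[of "\<lambda>x r l. (norm r)\<^sup>2" "Suc n"]
    integrable_state[of "\<lambda>x r l. Pq (x - xs)" "Suc n"] integrable_dw
  by (intro Bochner_Integration.integrable_add Bochner_Integration.integrable_sum
      integrable_divide_zero integrable_mult_right Bochner_Integration.integrable_diff) simp_all

text \<open>As \<open>E\<close> belongs to the history, its indicator may multiply the block gains,
  and the deviation \<open>Z\<close> of the chosen gain from the average integrates to 0.\<close>

lemma lyap_expectation_step:
  assumes E: "E \<in> sets (Fl (Suc n))"
  shows "(\<integral>w. lyap (Suc n) w * indicator E w \<partial>M)
    \<le> (\<integral>w. lyap n w * indicator E w \<partial>M) - (\<integral>w. decrease (Suc n) w * indicator E w \<partial>M)"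
proof -
  let ?I = "\<lambda>i. {w \<in> space M. ik (Suc n) w = i}"
  have EM: "E \<in> sets M" using E sets_Fl_M by blast
  define h where "h i w = block_gain (Suc n) i w * indicator E w" for i w
  define Z where "Z w = (\<Sum>i<m. h i w * indicator (?I i) w - h i w / m)" for w
  have simple_h: "simple_function (Fl (Suc n)) (h i)" for i
    unfolding h_def by (intro simple_function_mult simple_block_gain simple_function_indicator E)
  have int_h: "integrable M (h i)" for i by (intro integrable_simple_real simple_Fl_M[OF simple_h])
  have int_hI: "integrable M (\<lambda>w. h i w * indicator (?I i) w)" for i
    by (intro integrable_real_mult_indicator sets_ik int_h)
  have int_Z: "integrable M Z"
    unfolding Z_def using int_h int_hI by (intro Bochner_Integration.integrable_sum Bochner_Integration.integrable_diff integrable_divide_zero) auto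
  have Z0: "(\<integral>w. Z w \<partial>M) = 0"
    unfolding Z_def using int_h int_hI
    by (subst Bochner_Integration.integral_sum) (auto simp: expectation_block_indicator[OF simple_h])
  have int_l: "integrable M (\<lambda>w. lyap k w * indicator E w)"
    and int_d: "integrable M (\<lambda>w. decrease k w * indicator E w)" for k
    by (intro integrable_real_mult_indicator integrable_lyap integrable_decrease EM)+
  have "(\<integral>w. lyap (Suc n) w * indicator E w \<partial>M)
      \<le> (\<integral>w. lyap n w * indicator E w - decrease (Suc n) w * indicator E w + Z w \<partial>M)"
  proof (rule integral_mono_AE)
    show "AE w in M. lyap (Suc n) w * indicator E w
        \<le> lyap n w * indicator E w - decrease (Suc n) w * indicator E w + Z w"
      using AE_ik_less[of "Suc n"] AE_space
    proof eventually_elim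
      case (elim w)
      have "(\<Sum>i<m. h i w * indicator (?I i) w) = (\<Sum>i<m. if i = ik (Suc n) w then h i w else 0)"
        using elim by (intro sum.cong) (auto simp: indicator_def)
      then have "Z w = h (ik (Suc n) w) w - (\<Sum>i<m. h i w) / m"
        using elim unfolding Z_def sum_subtractf by (simp add: sum_divide_distrib sum.delta)
      then show ?case
        using lyap_step[OF elim(2,1)] by (cases "w \<in> E") (auto simp: h_def)
    qed
  qed (use int_l int_d int_Z in auto)
  also have "\<dots> = (\<integral>w. lyap n w * indicator E w \<partial>M) - (\<integral>w. decrease (Suc n) w * indicator E w \<partial>M)"
    using int_l int_d int_Z Z0 by simp
  finally show ?thesis .
qed

text \<open>The event is fixed once and the sum starts at \<open>N\<close>, since
  \<open>lyap N\<close> already refers to iterate \<open>Suc N\<close>. On it all later energies and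
  decreases are nonnegative, so telescoping bounds the sum of the decreases.\<close>

lemma decrease_expectation_tendsto:
  "(\<lambda>k. \<integral>w. decrease k w * indicator (dom_event (Suc N)) w \<partial>M) \<longlonglongrightarrow> 0"
proof -
  let ?E = "dom_event (Suc N)"
  define a where "a j = (\<integral>w. lyap (N + j) w * indicator ?E w \<partial>M)" for j
  define c where "c j = (\<integral>w. decrease (Suc N + j) w * indicator ?E w \<partial>M)" for j
  have E: "?E \<in> sets (Fl (Suc (N + j)))" for j
    using sets_dom_event[of "Suc N"] sets_Fl_mono[of "Suc N" "Suc (N + j)"] by auto
  have sub: "?E \<subseteq> dom_event (Suc N + j)" for j by (rule dom_event_mono) simp
  have c_nonneg: "c j \<ge> 0" for j
    unfolding c_def using decrease_nonneg[of _ "Suc N + j"] sub[of j]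
    by (intro Bochner_Integration.integral_nonneg) (auto simp: indicator_def)
  have a_nonneg: "a j \<ge> 0" for j
    unfolding a_def using lyap_nonneg[of _ "N + j"] sub[of j]
    by (intro Bochner_Integration.integral_nonneg) (auto simp: indicator_def)
  have step: "a (Suc j) \<le> a j - c j" for j
    using lyap_expectation_step[OF E[of j]] by (simp add: a_def c_def)
  have bound: "a j + (\<Sum>i<j. c i) \<le> a 0" for j
  proof (induction j)
    case (Suc j)
    then show ?case using step[of j] by simp
  qed simp
  have "(\<Sum>i<j. c i) \<le> a 0" for j using a_nonneg[of j] bound[of j] by linarith
  then have "summable c" using c_nonneg by (intro summableI_nonneg_bounded[of c "a 0"])
  then have "c \<longlonglongrightarrow> 0" by (rule summable_LIMSEQ_zero)
  then show ?thesis
    unfolding c_def add.commute[of "Suc N"] by (rule LIMSEQ_offset)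
qed

text \<open>First a domain event of probability close to 1 is fixed; on it Markov's inequality
  applies to the decrease, whose expectation tends to 0.\<close>

lemma prob_tendsto_zero:
  assumes c: "c > 0"
    and bad: "\<And>k. bad k \<in> sets M"
    and large: "\<And>k w. w \<in> dom_event k \<Longrightarrow> w \<in> bad k \<Longrightarrow> decrease k w \<ge> c"
  shows "(\<lambda>k. prob (bad k)) \<longlonglongrightarrow> 0"
proof (rule LIMSEQ_I)
  fix e :: real
  assume e: "e > 0"
  have "\<forall>\<^sub>F N in sequentially. prob (space M - dom_event N) < e / 2"
    using prob_dom_event_tendsto e by (intro order_tendstoD(2)) auto
  then obtain N0 where "\<And>N. N \<ge> N0 \<Longrightarrow> prob (space M - dom_event N) < e / 2"
    by (auto simp: eventually_sequentially)
  then have N: "prob (space M - dom_event (Suc N0)) < e / 2" by simp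
  let ?E = "dom_event (Suc N0)"
  have EM: "?E \<in> sets M" using sets_dom_event sets_Fl_M by blast
  have "\<forall>\<^sub>F k in sequentially. (\<integral>w. decrease k w * indicator ?E w \<partial>M) < c * e / 2"
    using decrease_expectation_tendsto[of N0] e c by (intro order_tendstoD(2)) auto
  then obtain K where K: "\<And>k. k \<ge> K \<Longrightarrow> (\<integral>w. decrease k w * indicator ?E w \<partial>M) < c * e / 2"
    by (auto simp: eventually_sequentially)
  show "\<exists>no. \<forall>k\<ge>no. norm (prob (bad k) - 0) < e"
  proof (intro exI allI impI)
    fix k assume k: "max K (Suc N0) \<le> k"
    then have sub: "?E \<subseteq> dom_event k" by (intro dom_event_mono) simp
    have int: "integrable M (\<lambda>w. decrease k w * indicator ?E w)"
      by (intro integrable_real_mult_indicator integrable_decrease EM)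
    have "prob {w \<in> space M. decrease k w * indicator ?E w \<ge> c}
        \<le> (\<integral>w. decrease k w * indicator ?E w \<partial>M) / c"
      using sub decrease_nonneg
      by (intro integral_Markov_inequality_measure[OF int sets.top _ c] AE_I2) (auto simp: indicator_def)
    also have "\<dots> < (c * e / 2) / c"
      using K[of k] k c by (intro divide_strict_right_mono) auto
    finally have markov: "prob {w \<in> space M. decrease k w * indicator ?E w \<ge> c} < e / 2"
      using c by simp
    have meas: "{w \<in> space M. decrease k w * indicator ?E w \<ge> c} \<in> sets M"
      using borel_measurable_integrable[OF int] by measurable
    have "bad k \<subseteq> (space M - ?E) \<union> {w \<in> space M. decrease k w * indicator ?E w \<ge> c}"
      using large[of _ k] sub sets.sets_into_space[OF bad[of k]] by (auto simp: indicator_def)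
    then have "prob (bad k) \<le> prob ((space M - ?E) \<union> {w \<in> space M. decrease k w * indicator ?E w \<ge> c})"
      using EM meas by (intro finite_measure_mono) auto
    also have "\<dots> \<le> prob (space M - ?E) + prob {w \<in> space M. decrease k w * indicator ?E w \<ge> c}"
      using EM meas by (intro measure_Un_le) auto
    also have "\<dots> < e" using N markov by simp
    finally show "norm (prob (bad k) - 0) < e" by simp
  qed
qed

section \<open>Convergence in probability\<close>

lemma residual_large:
  assumes "w \<in> dom_event k" "e < norm (r k w)" "e > 0"
  shows "decrease k w \<ge> \<rho> / (2 * m) * e\<^sup>2"
proof -
  have "e\<^sup>2 \<le> (norm (r k w))\<^sup>2" using assms by (intro power_mono) auto
  then have "\<rho> / (2 * m) * e\<^sup>2 \<le> \<rho> / (2 * m) * (norm (r k w))\<^sup>2"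
    using \<rho>_pos by (intro mult_left_mono) auto
  moreover have "Phi k w / m \<ge> 0" using Phi_nonneg[OF assms(1)] by simp
  ultimately show ?thesis by (simp add: decrease_def)
qed

theorem residual_tendsto:
  assumes "e > 0"
  shows "(\<lambda>k. prob {w \<in> space M. e < norm (r k w)}) \<longlonglongrightarrow> 0"
proof (rule prob_tendsto_zero[of "\<rho> / (2 * m) * e\<^sup>2"])
  show "{w \<in> space M. e < norm (r k w)} \<in> sets M" for k
    using sets_Fl_M[OF sets_state[of "\<lambda>y. e < norm (A *v y - b)" k]] by (simp add: r_eq cong: conj_cong)
  show "\<rho> / (2 * m) * e\<^sup>2 > 0" using assms \<rho>_pos m_pos by simp
  show "\<rho> / (2 * m) * e\<^sup>2 \<le> decrease k w"
    if "w \<in> dom_event k" "w \<in> {w \<in> space M. e < norm (r k w)}" for k w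
    by (rule residual_large) (use that assms in auto)
qed

theorem objective_tendsto:
  assumes e: "e > 0"
  shows "(\<lambda>k. prob {w \<in> space M. ereal e < \<bar>Fobj f g m (x k w) - Fobj f g m xs\<bar>}) \<longlonglongrightarrow> 0"
proof -
  \<comment> \<open>Chosen so that \<open>(norm lams + 1) * \<eta> = e / 2\<close>; the 1 guards
    against \<open>lams = 0\<close>.\<close>
  define \<eta> where "\<eta> = e / (2 * (norm lams + 1))"
  have \<eta>: "\<eta> > 0" unfolding \<eta>_def using e by (intro divide_pos_pos) (auto simp: add_nonneg_pos)
  define c where "c = min (e / 2 / m) (\<rho> / (2 * m) * \<eta>\<^sup>2)"
  show ?thesis
  proof (rule prob_tendsto_zero[of c])
    show "c > 0" using e \<eta> \<rho>_pos m_pos by (simp add: c_def)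
    show "{w \<in> space M. ereal e < \<bar>Fobj f g m (x k w) - Fobj f g m xs\<bar>} \<in> sets M" for k
      by (rule sets_Fl_M[OF sets_state])
    fix k w
    assume w: "w \<in> dom_event k"
      and "w \<in> {w \<in> space M. ereal e < \<bar>Fobj f g m (x k w) - Fobj f g m xs\<bar>}"
    then have big: "e < \<bar>gap (x k w)\<bar>" using gap_eq[of "x k w"] by (auto simp: dom_event_def)
    show "decrease k w \<ge> c"
    proof (cases "\<eta> < norm (r k w)")
      case True
      then show ?thesis using residual_large[OF w True \<eta>] by (simp add: c_def)
    next
      case False
      have "\<bar>lams \<bullet> r k w\<bar> \<le> norm lams * norm (r k w)" by (rule Cauchy_Schwarz_ineq2)
      also have "\<dots> \<le> (norm lams + 1) * \<eta>" using False by (intro mult_mono) auto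
      also have "\<dots> = e / 2"
      proof -
        have "norm lams + 1 > 0" by (simp add: add_nonneg_pos)
        then show ?thesis by (simp add: \<eta>_def field_simps)
      qed
      \<comment> \<open>With the multiplier term at most \<open>e / 2\<close>, nonnegativity of
        \<open>Phi\<close> excludes \<open>gap < - e\<close>; hence \<open>gap > e\<close>.\<close>
      finally have "Phi k w \<ge> e / 2"
        using big Phi_nonneg[OF w] by (simp add: Phi_def)
      then have "Phi k w / m \<ge> e / 2 / m" by (intro divide_right_mono) auto
      moreover have "\<rho> / (2 * m) * (norm (r k w))\<^sup>2 \<ge> 0" using \<rho>_pos by simp
      ultimately show ?thesis by (simp add: decrease_def c_def)
    qed
  qed
qed

end

text \<open>In the first limit an infinite objective value counts as a deviation, so the early
  iterates may lie outside the domain.\<close>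

theorem mainTheorem11:
  fixes M :: "'w measure" and Fl :: "nat \<Rightarrow> 'w measure"
    and blk :: "'n::finite \<Rightarrow> nat" and m :: nat
    and f :: "real^'n \<Rightarrow> real" and gradf :: "real^'n \<Rightarrow> real^'n"
    and g :: "nat \<Rightarrow> real^'n \<Rightarrow> ereal"
    and A :: "real^'n^'q::finite" and b :: "real^'q"
    and L :: "nat \<Rightarrow> real" and Lr :: real
    and P :: "nat \<Rightarrow> real^'n^'n"
    and \<beta> \<rho> \<alpha> :: real and \<tau> :: nat
    and xs :: "real^'n" and lams :: "real^'q"
    and x0 :: "real^'n"
    and ik :: "nat \<Rightarrow> 'w \<Rightarrow> nat"
    and x xhat :: "nat \<Rightarrow> 'w \<Rightarrow> real^'n"
    and r lam :: "nat \<Rightarrow> 'w \<Rightarrow> real^'q"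
  defines "F \<equiv> Fobj f g m"
    and "Lc \<equiv> Max (L ` {..<m})"
    and "\<kappa> \<equiv> Lr / Max (L ` {..<m})"
  assumes M: "prob_space M"
    \<comment> \<open>blocks\<close>
    and m_pos: "m \<ge> 1"
    and blk_range: "\<forall>j. blk j < m"
    \<comment> \<open>f convex, continuously differentiable with gradient gradf\<close>
    and f_convex: "convex_on UNIV f"
    and f_grad: "\<forall>y. (f has_derivative (\<lambda>h. gradf y \<bullet> h)) (at y)"
    and gradf_cont: "continuous_on UNIV gradf"
    \<comment> \<open>g_i proper, convex, lsc, depending only on block i\<close>
    and g_block: "\<forall>i<m. \<forall>y z. (\<forall>j. blk j = i \<longrightarrow> y $ j = z $ j) \<longrightarrow> g i y = g i z"
    and g_proper: "\<forall>i<m. proper_ext (g i)"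
    and g_convex: "\<forall>i<m. convex_ext (g i)"
    and g_lsc: "\<forall>i<m. lsc_ext (g i)"
    \<comment> \<open>existence of a solution\<close>
    and sol_feas: "A *v xs = b"
    and sol_fin: "F xs \<noteq> \<infinity>"
    and sol_opt: "\<forall>y. F y - F xs - ereal (lams \<bullet> (A *v y - b)) \<ge> 0"
    \<comment> \<open>gradient Lipschitz continuity\<close>
    and L_pos: "\<forall>i<m. L i > 0"
    and Lip_i: "\<forall>i<m. \<forall>y z. norm (Ublk blk i (gradf (y + Ublk blk i z)) - Ublk blk i (gradf y))
                    \<le> L i * norm (Ublk blk i z)"
    and Lip_r: "\<forall>i<m. \<forall>y z. norm (gradf (y + Ublk blk i z) - gradf y) \<le> Lr * norm (Ublk blk i z)"
    \<comment> \<open>parameters\<close>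
    and \<beta>_pos: "\<beta> > 0" and \<rho>_pos: "\<rho> > 0" and \<rho>_le: "\<rho> \<le> \<beta> / real m"
    and \<alpha>_pos: "\<alpha> > 0"
    \<comment> \<open>P_i: symmetric matrices acting on block i, with the Loewner lower bound\<close>
    and P_sym: "\<forall>i<m. transpose (P i) = P i"
    and P_block: "\<forall>i<m. \<forall>j l. (blk j \<noteq> i \<or> blk l \<noteq> i) \<longrightarrow> P i $ j $ l = 0"
    and P_bound: "\<forall>i<m. \<forall>y. (\<forall>j. blk j \<noteq> i \<longrightarrow> y $ j = 0) \<longrightarrow>
        y \<bullet> (P i *v y) \<ge>
          (L i + \<alpha> * Lc + \<tau> * L i / m + (\<kappa> / \<alpha> + 2) * Lr * \<tau>\<^sup>2 / m) * (y \<bullet> y)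
          + \<beta> * ((A *v y) \<bullet> (A *v y))"
    \<comment> \<open>filtration (history) and measurability\<close>
    and Fl_sub: "\<forall>k. subalgebra M (Fl k)"
    and Fl_mono: "\<forall>k. sets (Fl k) \<subseteq> sets (Fl (Suc k))"
    and x_meas: "\<forall>k. x k \<in> borel_measurable (Fl k)"
    and xhat_meas: "\<forall>k. xhat k \<in> borel_measurable (Fl k)"
    and ik_meas: "\<forall>k. ik k \<in> measurable (Fl (Suc k)) (count_space UNIV)"
    \<comment> \<open>i_k uniform on blocks conditionally on the history before iteration k\<close>
    and ik_unif: "\<forall>k. \<forall>i<m. \<forall>E\<in>sets (Fl k).
        measure M (E \<inter> {w \<in> space M. ik k w = i}) = measure M E / real m"
    \<comment> \<open>bounded delay\<close>
    and delay: "\<forall>k. \<forall>w\<in>space M. \<exists>J. J \<subseteq> {k - \<tau>..<k} \<and>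
        xhat k w = x k w + (\<Sum>d\<in>J. x d w - x (Suc d) w)"
    \<comment> \<open>Algorithm 2\<close>
    and x_init: "\<forall>w\<in>space M. x 0 w = x0"
    and r_init: "\<forall>w\<in>space M. r 0 w = A *v x0 - b"
    and lam_init: "\<forall>w\<in>space M. lam 0 w = 0"
    and x_other: "\<forall>k. \<forall>w\<in>space M. \<forall>j. blk j \<noteq> ik k w \<longrightarrow> x (Suc k) w $ j = x k w $ j"
    and x_argmin: "\<forall>k. \<forall>w\<in>space M. \<forall>z. (\<forall>j. blk j \<noteq> ik k w \<longrightarrow> z $ j = x k w $ j) \<longrightarrow>
        ereal ((Ublk blk (ik k w) (gradf (xhat k w)
                  - transpose A *v (lam k w - \<beta> *\<^sub>R r k w))) \<bullet> x (Suc k) w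
               + (1/2) * ((x (Suc k) w - x k w) \<bullet> (P (ik k w) *v (x (Suc k) w - x k w))))
          + g (ik k w) (x (Suc k) w)
        \<le> ereal ((Ublk blk (ik k w) (gradf (xhat k w)
                  - transpose A *v (lam k w - \<beta> *\<^sub>R r k w))) \<bullet> z
               + (1/2) * ((z - x k w) \<bullet> (P (ik k w) *v (z - x k w))))
          + g (ik k w) z"
    and r_step: "\<forall>k. \<forall>w\<in>space M. r (Suc k) w = r k w + A *v (Ublk blk (ik k w) (x (Suc k) w - x k w))"
    and lam_step: "\<forall>k. \<forall>w\<in>space M. lam (Suc k) w = lam k w - \<rho> *\<^sub>R r (Suc k) w"
  shows "(\<forall>\<epsilon>>0. (\<lambda>k. measure M {w \<in> space M. ereal \<epsilon> < \<bar>F (x k w) - F xs\<bar>}) \<longlonglongrightarrow> 0)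
       \<and> (\<forall>\<epsilon>>0. (\<lambda>k. measure M {w \<in> space M. \<epsilon> < norm (r k w)}) \<longlonglongrightarrow> 0)"
proof -
  have Lc_pos: "Lc > 0"
  proof -
    \<comment> \<open>The maximum is attained because there is at least one block.\<close>
    have "Lc \<in> L ` {..<m}" unfolding Lc_def using m_pos by (intro Max_in) (auto simp: lessThan_empty_iff)
    then show ?thesis using L_pos by auto
  qed
  have \<kappa>: "\<kappa> = Lr / Lc" by (simp add: \<kappa>_def Lc_def)
  interpret async_iteration M blk m f gradf g A b L Lr P \<beta> \<rho> \<alpha> \<tau> xs lams Lc Fl x0 ik x xhat r lam
  proof (intro async_iteration.intro block_problem.intro async_iteration_axioms.intro)
    show "prob_space M" by (rule M)
    show "Fobj f g m xs \<noteq> \<infinity>" using sol_fin by (simp add: F_def)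
    show "0 \<le> Fobj f g m y - Fobj f g m xs - ereal (lams \<bullet> (A *v y - b))" for y
      using sol_opt by (simp add: F_def)
    show "(L i + \<alpha> * Lc + \<tau> * L i / m + (Lr / Lc / \<alpha> + 2) * Lr * \<tau>\<^sup>2 / m) * (y \<bullet> y)
        + \<beta> * ((A *v y) \<bullet> (A *v y)) \<le> y \<bullet> (P i *v y)"
      if "i < m" "\<And>j. blk j \<noteq> i \<Longrightarrow> y $ j = 0" for i y
      using P_bound that unfolding \<kappa> by blast
    show "g i y = g i z" if "i < m" "\<And>j. blk j = i \<Longrightarrow> y $ j = z $ j" for i y z
      using g_block that by blast
    show "P i $ j $ l = 0" if "i < m" "blk j \<noteq> i \<or> blk l \<noteq> i" for i j l
      using P_block that by blast
    show "ereal ((Ublk blk (ik k w) (gradf (xhat k w) - transpose A *v (lam k w - \<beta> *\<^sub>R r k w))) \<bullet> x (Suc k) w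
               + (1/2) * ((x (Suc k) w - x k w) \<bullet> (P (ik k w) *v (x (Suc k) w - x k w))))
          + g (ik k w) (x (Suc k) w)
        \<le> ereal ((Ublk blk (ik k w) (gradf (xhat k w) - transpose A *v (lam k w - \<beta> *\<^sub>R r k w))) \<bullet> z
               + (1/2) * ((z - x k w) \<bullet> (P (ik k w) *v (z - x k w))))
          + g (ik k w) z"
      if "w \<in> space M" "\<And>j. blk j \<noteq> ik k w \<Longrightarrow> z $ j = x k w $ j" for k w z
      using x_argmin that by blast
  qed (rule Lc_pos m_pos blk_range f_convex f_grad[rule_format] g_proper[rule_format]
      g_convex[rule_format] sol_feas L_pos[rule_format] Lip_i[rule_format] Lip_r[rule_format]
      \<beta>_pos \<rho>_pos \<rho>_le \<alpha>_pos P_sym[rule_format] Fl_sub[rule_format] Fl_mono[rule_format]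
      x_meas[rule_format] xhat_meas[rule_format] ik_meas[rule_format] ik_unif[rule_format]
      delay[rule_format] x_init[rule_format] r_init[rule_format] lam_init[rule_format]
      x_other[rule_format] r_step[rule_format] lam_step[rule_format]; assumption)+
  show ?thesis unfolding F_def using objective_tendsto residual_tendsto by blast
qed

end
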